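(* Let $f=\frac1n\sum_{i=1}^n f_i$ with $f_i=\frac1m\sum_{j=1}^m f_{ij}$, where each $f_{ij}:\mathbb{R}^d\to\mathbb{R}$ is convex and $L$-smooth and each $f_i$ is $\mu$-strongly convex, $\mu>0$. Let $x^\star$ be the minimizer of $f$. Consider the VR-DIANA algorithm (either Variant 1 or Variant 2, described in the context) with an $\omega$-quantization operator $Q$, step size $0<\alpha\le\frac1{\omega+1}$ and $$\gamma=\frac{1}{L\left(1+36(\omega+1)/n\right)}.$$ Let $b=\frac{4(\omega+1)}{\alpha n^2}$, $c=\frac{16(\omega+1)}{n^2}$ and define $$\psi^k=\|x^k-x^\star\|_2^2+b\gamma^2H^k+c\gamma^2D^k,$$ $$H^k=\sum_{i=1}^n\|h_i^k-\nabla f_i(x^\star)\|_2^2,\qquad D^k=\sum_{i=1}^n\sum_{j=1}^m\|\nabla f_{ij}(w_{ij}^k)-\nabla f_{ij}(x^\star)\|_2^2 .$$ Then for every $k\ge0$, with the expectation conditioned on the state of the algorithm at iteration $k$ (that is, on $x^k$, $(h_i^k)_i$, $(w_{ij}^k)_{i,j}$), $$\mathbb{E}[\psi^{k+1}]\le(1-\rho)\,\psi^k,\qquad \rho=\min\left\{\frac{\mu}{L\left(1+36\frac{\omega+1}{n}\right)},\ \frac{\alpha}{2},\ \frac{3}{8m}\right\}.$$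
   Context: Differentiable $f$ is $\mu$-strongly convex if $f(y)\ge f(x)+\langle\nabla f(x),y-x\rangle+\frac{\mu}{2}\|x-y\|_2^2$ for all $x,y$; it is $L$-smooth ($L>0$) if $f(y)\le f(x)+\langle\nabla f(x),y-x\rangle+\frac L2\|x-y\|_2^2$ for all $x,y$. An $\omega$-quantization operator ($\omega\ge0$) is a random map $Q:\mathbb{R}^d\to\mathbb{R}^d$ such that for all $x$: $\mathbb{E}_Q[Q(x)]=x$ and $\mathbb{E}_Q[\|Q(x)\|_2^2]\le(\omega+1)\|x\|_2^2$. VR-DIANA algorithm. Input: $\alpha,\gamma>0$, vectors $x^0$, $h_i^0$, $w_{ij}^0\in\mathbb{R}^d$ ($1\le i\le n$, $1\le j\le m$). For $k=0,1,2,\dots$: (Variant 1 only) draw $u^k\in\{0,1\}$ with $P(u^k=1)=\frac1m$. For each worker $i=1,\dots,n$: draw $j_i^k$ uniformly at random from $\{1,\dots,m\}$; set $\mu_i^k=\frac1m\sum_{j=1}^m\nabla f_{ij}(w_{ij}^k)$, $g_i^k=\nabla f_{ij_i^k}(x^k)-\nabla f_{ij_i^k}(w_{ij_i^k}^k)+\mu_i^k$, $\hat\Delta_i^k=Q(g_i^k-h_i^k)$, $h_i^{k+1}=h_i^k+\alpha\hat\Delta_i^k$; and update, for all $j$: in Variant 1 (L-SVRG) $w_{ij}^{k+1}=x^k$ if $u^k=1$ and $w_{ij}^{k+1}=w_{ij}^k$ if $u^k=0$; in Variant 2 (SAGA) $w_{ij}^{k+1}=x^k$ if $j=j_i^k$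 and $w_{ij}^{k+1}=w_{ij}^k$ otherwise. Then set $g^k=\frac1n\sum_{i=1}^n(\hat\Delta_i^k+h_i^k)$ and $x^{k+1}=x^k-\gamma g^k$. All random draws ($u^k$, the $j_i^k$, and the internal randomness of each application of $Q$) are mutually independent and independent of the past. *)

theory Defs
  imports "HOL-Probability.Probability"
begin

definition gradient :: "('v::real_inner \<Rightarrow> real) \<Rightarrow> 'v \<Rightarrow> 'v" where
  "gradient f x = (THE D. GDERIV f x :> D)"

definition strongly_convex :: "real \<Rightarrow> ('v::real_inner \<Rightarrow> real) \<Rightarrow> bool" where
  "strongly_convex \<mu> f \<longleftrightarrow> (\<forall>x. f differentiable (at x)) \<and>
     (\<forall>x y. f y \<ge> f x + gradient f x \<bullet> (y - x) + \<mu> / 2 * (norm (x - y))\<^sup>2)"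

definition L_smooth :: "real \<Rightarrow> ('v::real_inner \<Rightarrow> real) \<Rightarrow> bool" where
  "L_smooth L f \<longleftrightarrow> L > 0 \<and> (\<forall>x. f differentiable (at x)) \<and>
     (\<forall>x y. f y \<le> f x + gradient f x \<bullet> (y - x) + L / 2 * (norm (x - y))\<^sup>2)"

(* A random map is a family of maps indexed by a seed drawn from the probability space R.
   Joint measurability makes sense of applying it to a random argument. *)
definition quantization_operator ::
    "real \<Rightarrow> 'r measure \<Rightarrow> ('r \<Rightarrow> 'v::euclidean_space \<Rightarrow> 'v) \<Rightarrow> bool" where
  "quantization_operator \<omega> R Q \<longleftrightarrow> \<omega> \<ge> 0 \<and> prob_space R \<and>
     (\<lambda>(s, x). Q s x) \<in> borel_measurable (R \<Otimes>\<^sub>M borel) \<and>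
     (\<forall>x. integrable R (\<lambda>s. Q s x) \<and> (\<integral>s. Q s x \<partial>R) = x \<and>
          integrable R (\<lambda>s. (norm (Q s x))\<^sup>2) \<and>
          (\<integral>s. (norm (Q s x))\<^sup>2 \<partial>R) \<le> (\<omega> + 1) * (norm x)\<^sup>2)"

text \<open>Workers are indexed by \<open>{1..n}\<close> and the functions of each worker by \<open>{1..m}\<close>;
  \<open>f i j\<close> is the \<open>j\<close>-th function of worker \<open>i\<close>.\<close>

definition worker_objective :: "nat \<Rightarrow> (nat \<Rightarrow> nat \<Rightarrow> 'v \<Rightarrow> real) \<Rightarrow> nat \<Rightarrow> 'v \<Rightarrow> real" where
  "worker_objective m f i x = (1 / real m) * (\<Sum>j=1..m. f i j x)"

definition objective :: "nat \<Rightarrow> nat \<Rightarrow> (nat \<Rightarrow> nat \<Rightarrow> 'v \<Rightarrow> real) \<Rightarrow> 'v \<Rightarrow> real" where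
  "objective n m f x = (1 / real n) * (\<Sum>i=1..n. worker_objective m f i x)"

datatype variant = L_SVRG | SAGA

record 'v vr_state =
  st_x :: 'v
  st_h :: "nat \<Rightarrow> 'v"
  st_w :: "nat \<Rightarrow> nat \<Rightarrow> 'v"

definition vr_estimator ::
    "nat \<Rightarrow> (nat \<Rightarrow> nat \<Rightarrow> 'v::real_inner \<Rightarrow> real) \<Rightarrow> 'v vr_state \<Rightarrow> nat \<Rightarrow> nat \<Rightarrow> 'v" where
  "vr_estimator m f \<sigma> i j =
     gradient (f i j) (st_x \<sigma>) - gradient (f i j) (st_w \<sigma> i j)
     + (1 / real m) *\<^sub>R (\<Sum>l=1..m. gradient (f i l) (st_w \<sigma> i l))"

definition vr_delta ::
    "nat \<Rightarrow> (nat \<Rightarrow> nat \<Rightarrow> 'v::real_inner \<Rightarrow> real) \<Rightarrow> ('r \<Rightarrow> 'v \<Rightarrow> 'v) \<Rightarrow>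
     (nat \<Rightarrow> nat) \<Rightarrow> (nat \<Rightarrow> 'r) \<Rightarrow> 'v vr_state \<Rightarrow> nat \<Rightarrow> 'v" where
  "vr_delta m f Q J S \<sigma> i = Q (S i) (vr_estimator m f \<sigma> i (J i) - st_h \<sigma> i)"

(* U, J i, S i: the outcomes of the coin, of worker i's index draw and of worker i's
   quantization seed in the current iteration; the SAGA variant ignores U. *)
definition vr_diana_step ::
    "variant \<Rightarrow> nat \<Rightarrow> nat \<Rightarrow> (nat \<Rightarrow> nat \<Rightarrow> 'v::real_inner \<Rightarrow> real) \<Rightarrow> ('r \<Rightarrow> 'v \<Rightarrow> 'v) \<Rightarrow>
     real \<Rightarrow> real \<Rightarrow> bool \<Rightarrow> (nat \<Rightarrow> nat) \<Rightarrow> (nat \<Rightarrow> 'r) \<Rightarrow> 'v vr_state \<Rightarrow> 'v vr_state" where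
  "vr_diana_step v n m f Q \<alpha> \<gamma> U J S \<sigma> =
     \<lparr> st_x = st_x \<sigma> - \<gamma> *\<^sub>R ((1 / real n) *\<^sub>R (\<Sum>i=1..n. vr_delta m f Q J S \<sigma> i + st_h \<sigma> i)),
       st_h = (\<lambda>i. st_h \<sigma> i + \<alpha> *\<^sub>R vr_delta m f Q J S \<sigma> i),
       st_w = (\<lambda>i j. if (case v of L_SVRG \<Rightarrow> U | SAGA \<Rightarrow> j = J i) then st_x \<sigma> else st_w \<sigma> i j) \<rparr>"

primrec vr_diana ::
    "variant \<Rightarrow> nat \<Rightarrow> nat \<Rightarrow> (nat \<Rightarrow> nat \<Rightarrow> 'v::real_inner \<Rightarrow> real) \<Rightarrow> ('r \<Rightarrow> 'v \<Rightarrow> 'v) \<Rightarrow>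
     real \<Rightarrow> real \<Rightarrow> 'v vr_state \<Rightarrow>
     (nat \<Rightarrow> 'a \<Rightarrow> bool) \<Rightarrow> (nat \<Rightarrow> nat \<Rightarrow> 'a \<Rightarrow> nat) \<Rightarrow> (nat \<Rightarrow> nat \<Rightarrow> 'a \<Rightarrow> 'r) \<Rightarrow>
     nat \<Rightarrow> 'a \<Rightarrow> 'v vr_state" where
  "vr_diana v n m f Q \<alpha> \<gamma> \<sigma>0 U J S 0 z = \<sigma>0"
| "vr_diana v n m f Q \<alpha> \<gamma> \<sigma>0 U J S (Suc k) z =
     vr_diana_step v n m f Q \<alpha> \<gamma> (U k z) (\<lambda>i. J k i z) (\<lambda>i. S k i z)
       (vr_diana v n m f Q \<alpha> \<gamma> \<sigma>0 U J S k z)"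

datatype draw = Coin nat | Index nat nat | Seed nat nat

fun draw_sets ::
    "'a measure \<Rightarrow> 'r measure \<Rightarrow> (nat \<Rightarrow> 'a \<Rightarrow> bool) \<Rightarrow> (nat \<Rightarrow> nat \<Rightarrow> 'a \<Rightarrow> nat) \<Rightarrow>
     (nat \<Rightarrow> nat \<Rightarrow> 'a \<Rightarrow> 'r) \<Rightarrow> draw \<Rightarrow> 'a set set" where
  "draw_sets M R U J S (Coin k) = sets (vimage_algebra (space M) (U k) (count_space UNIV))"
| "draw_sets M R U J S (Index k i) = sets (vimage_algebra (space M) (J k i) (count_space UNIV))"
| "draw_sets M R U J S (Seed k i) = sets (vimage_algebra (space M) (S k i) R)"

definition draws_of :: "variant \<Rightarrow> nat \<Rightarrow> draw set" where
  "draws_of v n = (if v = L_SVRG then range Coin else {})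
     \<union> {Index k i | k i. i \<in> {1..n}} \<union> {Seed k i | k i. i \<in> {1..n}}"

(* The draws take values in different types, so their mutual independence is expressed by
   indep_sets on the generated sigma-algebras rather than by indep_vars. *)
definition vr_diana_draws ::
    "variant \<Rightarrow> nat \<Rightarrow> nat \<Rightarrow> 'a measure \<Rightarrow> 'r measure \<Rightarrow> (nat \<Rightarrow> 'a \<Rightarrow> bool) \<Rightarrow>
     (nat \<Rightarrow> nat \<Rightarrow> 'a \<Rightarrow> nat) \<Rightarrow> (nat \<Rightarrow> nat \<Rightarrow> 'a \<Rightarrow> 'r) \<Rightarrow> bool" where
  "vr_diana_draws v n m M R U J S \<longleftrightarrow>
     prob_space M \<and>
     (v = L_SVRG \<longrightarrow> (\<forall>k. U k \<in> measurable M (count_space UNIV) \<and>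
        distr M (count_space UNIV) (U k) = measure_pmf (bernoulli_pmf (1 / real m)))) \<and>
     (\<forall>k. \<forall>i\<in>{1..n}. J k i \<in> measurable M (count_space {1..m}) \<and>
        distr M (count_space {1..m}) (J k i) = uniform_count_measure {1..m}) \<and>
     (\<forall>k. \<forall>i\<in>{1..n}. S k i \<in> measurable M R \<and> distr M R (S k i) = R) \<and>
     prob_space.indep_sets M (draw_sets M R U J S) (draws_of v n)"

(* The sigma-algebra generated by x, (h_i) and (w_ij) for i in {1..n}, j in {1..m}. *)
definition state_algebra ::
    "'a measure \<Rightarrow> nat \<Rightarrow> nat \<Rightarrow> ('a \<Rightarrow> 'v::euclidean_space vr_state) \<Rightarrow> 'a measure" where
  "state_algebra M n m X = vimage_algebra (space M)
     (\<lambda>z. (st_x (X z), restrict (st_h (X z)) {1..n},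
           restrict (\<lambda>(i, j). st_w (X z) i j) ({1..n} \<times> {1..m})))
     (borel \<Otimes>\<^sub>M PiM {1..n} (\<lambda>_. borel) \<Otimes>\<^sub>M PiM ({1..n} \<times> {1..m}) (\<lambda>_. borel))"

definition H_term ::
    "nat \<Rightarrow> nat \<Rightarrow> (nat \<Rightarrow> nat \<Rightarrow> 'v::real_inner \<Rightarrow> real) \<Rightarrow> 'v \<Rightarrow> 'v vr_state \<Rightarrow> real" where
  "H_term n m f xs \<sigma> = (\<Sum>i=1..n. (norm (st_h \<sigma> i - gradient (worker_objective m f i) xs))\<^sup>2)"

definition D_term ::
    "nat \<Rightarrow> nat \<Rightarrow> (nat \<Rightarrow> nat \<Rightarrow> 'v::real_inner \<Rightarrow> real) \<Rightarrow> 'v \<Rightarrow> 'v vr_state \<Rightarrow> real" where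
  "D_term n m f xs \<sigma> =
     (\<Sum>i=1..n. \<Sum>j=1..m. (norm (gradient (f i j) (st_w \<sigma> i j) - gradient (f i j) xs))\<^sup>2)"

definition lyapunov ::
    "nat \<Rightarrow> nat \<Rightarrow> (nat \<Rightarrow> nat \<Rightarrow> 'v::real_inner \<Rightarrow> real) \<Rightarrow> 'v \<Rightarrow> real \<Rightarrow> real \<Rightarrow> real \<Rightarrow>
     'v vr_state \<Rightarrow> real" where
  "lyapunov n m f xs b c \<gamma> \<sigma> =
     (norm (st_x \<sigma> - xs))\<^sup>2 + b * \<gamma>\<^sup>2 * H_term n m f xs \<sigma> + c * \<gamma>\<^sup>2 * D_term n m f xs \<sigma>"

end

theory Submission
  imports Defs
begin

text \<open>
  Write \<open>x\<close> for the current iterate, \<open>B = objective x - objective xs\<close> for the optimality gap and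
  \<open>q\<close> for \<open>1 / m\<close> times the sum over all \<open>(i, j)\<close> of the squared distance between the gradients of
  \<open>f i j\<close> at \<open>x\<close> and at the minimizer \<open>xs\<close>. Three observations drive the proof.

  First, for convex \<open>L\<close>-smooth functions the squared gradient difference is at most \<open>2 * L\<close> times
  the Bregman distance (\<open>gradient_diff_le_bregman\<close>). The linear parts of these distances cancel in
  the sum because the gradient of the objective vanishes at \<open>xs\<close>, so \<open>q \<le> 2 * L * n * B\<close>
  (\<open>deviation_le_gap\<close>).

  Second, from a fixed state the quantized estimates of the workers are independent and unbiased,
  so the variance of their average is \<open>1 / n\<^sup>2\<close> times the sum of the individual variances. The
  variance of one estimate is at most \<open>\<omega>\<close> times the squared distance of the shift \<open>h\<close> from the
  gradient of the worker plus \<open>\<omega> + 1\<close> times the variance of the sampled gradient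
  (\<open>delta_moments\<close>, \<open>expected_iterate_error\<close>). Up to multiples of \<open>q\<close>, the first part is controlled
  by \<open>H\<close> and the second by \<open>D\<close>, both of which shrink in expectation up to multiples of \<open>q\<close> (and, for
  \<open>H\<close>, of \<open>D\<close>): \<open>expected_shift_error\<close>, \<open>expected_memory_error\<close>. The weights \<open>b\<close> and \<open>c\<close> are such
  that the shrinking pays for the noise, and the step size is such that all multiples of \<open>q\<close>
  together cost at most \<open>2 * \<gamma> * B\<close>, which strong convexity supplies
  (\<open>contraction_arithmetic\<close>, \<open>one_step_contraction\<close>).

  Third, the state after \<open>k\<close> rounds depends only on the earlier draws, and the draws of round \<open>k\<close>
  are independent of those. Tonelli's theorem then permits freezing the state while averaging over
  the current draws (\<open>nn_integral_decouple\<close>), so the bound from a fixed state holds after integration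
  over every event of the past, in particular over every event of the state algebra; this is
  the bound on the conditional expectation (\<open>nn_integral_contraction\<close>, \<open>real_cond_exp_le\<close>).
\<close>

section \<open>Gradients of smooth convex functions\<close>

lemma gradient_unique:
  assumes "GDERIV f x :> D"
  shows "gradient f x = D"
  unfolding gradient_def
proof (rule the_equality)
  show "GDERIV f x :> D"
    by (rule assms)
  fix D' assume "GDERIV f x :> D'"
  then have "(\<lambda>h. h \<bullet> D') = (\<lambda>h. h \<bullet> D)"
    using assms unfolding gderiv_def by (rule has_derivative_unique)
  then show "D' = D"
    by (metis vector_eq_ldot)
qed

lemma gderiv_gradient:
  fixes f :: "'v::euclidean_space \<Rightarrow> real"
  assumes "f differentiable (at x)"
  shows "GDERIV f x :> gradient f x"
proof -
  obtain f' where f': "(f has_derivative f') (at x)"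
    using assms by (auto simp: differentiable_def)
  then have "linear f'"
    by (rule has_derivative_linear)
  then have "f' = (\<lambda>h. h \<bullet> adjoint f' 1)"
    by (intro ext) (simp add: adjoint_works)
  then have "GDERIV f x :> adjoint f' 1"
    unfolding gderiv_def using f' by (rule has_derivative_eq_rhs[rotated])
  then show ?thesis
    by (simp add: gradient_unique)
qed

lemma gderiv_scaled_sum:
  assumes "\<And>i. i \<in> I \<Longrightarrow> GDERIV (F i) x :> D i"
  shows "GDERIV (\<lambda>x. r * (\<Sum>i\<in>I. F i x)) x :> r *\<^sub>R (\<Sum>i\<in>I. D i)"
  using assms unfolding gderiv_def
  by (auto intro!: derivative_eq_intros simp: inner_sum_right)

lemma differentiable_gderiv: "GDERIV f x :> D \<Longrightarrow> f differentiable (at x)"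
  unfolding gderiv_def differentiable_def by blast

text \<open>The one-dimensional tangent inequality, applied along the line from \<open>x\<close> to \<open>y\<close>.\<close>
lemma convex_above_gradient:
  fixes f :: "'v::euclidean_space \<Rightarrow> real"
  assumes convex: "convex_on UNIV f" and diff: "f differentiable (at x)"
  shows "f x + gradient f x \<bullet> (y - x) \<le> f y"
proof -
  define l where "l t = x + t *\<^sub>R (y - x)" for t :: real
  have "convex_on UNIV (\<lambda>t. f (l t))"
  proof (intro convex_onI)
    fix t a b :: real assume t: "0 < t" "t < 1"
    have "l ((1 - t) *\<^sub>R a + t *\<^sub>R b) = (1 - t) *\<^sub>R l a + t *\<^sub>R l b"
      by (simp add: l_def algebra_simps)
    then show "f (l ((1 - t) *\<^sub>R a + t *\<^sub>R b)) \<le> (1 - t) * f (l a) + t * f (l b)"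
      using convex_onD[OF convex, of t "l a" "l b"] t by simp
  qed auto
  moreover have "((\<lambda>t. f (l t)) has_field_derivative gradient f x \<bullet> (y - x)) (at 0)"
  proof -
    have "(f has_derivative (\<lambda>h. h \<bullet> gradient f x)) (at (l 0))"
      using gderiv_gradient[OF diff] by (simp add: gderiv_def l_def)
    moreover have "(l has_derivative (\<lambda>t. t *\<^sub>R (y - x))) (at 0)"
      unfolding l_def by (auto intro!: derivative_eq_intros)
    ultimately have "((\<lambda>t. f (l t)) has_derivative (\<lambda>t. (t *\<^sub>R (y - x)) \<bullet> gradient f x)) (at 0)"
      by (rule has_derivative_compose[rotated])
    moreover have "(\<lambda>t. (t *\<^sub>R (y - x)) \<bullet> gradient f x) = (*) (gradient f x \<bullet> (y - x))"
      by (rule ext) (simp only: inner_scaleR_left inner_commute[of "y - x"] mult.commute)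
    ultimately show ?thesis
      by (simp only: has_field_derivative_def)
  qed
  ultimately have "gradient f x \<bullet> (y - x) * (1 - 0) \<le> f (l 1) - f (l 0)"
    using convex_on_imp_above_tangent[of UNIV "\<lambda>t. f (l t)" 0 1] connected_UNIV by simp
  moreover have "l 0 = x" "l 1 = y"
    by (simp_all add: l_def)
  ultimately show ?thesis
    by simp
qed

text \<open>The function \<open>f\<close> minus its linearization at \<open>y\<close> is nonnegative by convexity, and by
  smoothness a gradient step of length \<open>1 / L\<close> from \<open>x\<close> decreases it by at least the squared norm
  of its gradient over \<open>2 * L\<close>. Hence its value at \<open>x\<close>, the Bregman distance, is at least that much.\<close>
lemma gradient_diff_le_bregman:
  fixes f :: "'v::euclidean_space \<Rightarrow> real"
  assumes convex: "convex_on UNIV f" and smooth: "L_smooth L f"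
  shows "(norm (gradient f x - gradient f y))\<^sup>2 \<le> 2 * L * (f x - f y - gradient f y \<bullet> (x - y))"
proof -
  define e where "e = gradient f x - gradient f y"
  define u where "u = x - (1 / L) *\<^sub>R e"
  have L: "L > 0"
    and upper: "f u \<le> f x + gradient f x \<bullet> (u - x) + L / 2 * (norm (x - u))\<^sup>2"
    and diff: "f differentiable (at y)"
    using smooth by (auto simp: L_smooth_def)
  have "f y + gradient f y \<bullet> (u - y) \<le> f u"
    using convex diff by (rule convex_above_gradient)
  then have "0 \<le> f x - f y - gradient f y \<bullet> (x - y) + e \<bullet> (u - x) + L / 2 * (norm (x - u))\<^sup>2"
    using upper by (simp add: e_def algebra_simps)
  also have "e \<bullet> (u - x) = - (norm e)\<^sup>2 / L"
    by (simp add: u_def power2_norm_eq_inner)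
  also have "(norm (x - u))\<^sup>2 = (norm e)\<^sup>2 / L\<^sup>2"
    by (simp add: u_def power_divide)
  finally show ?thesis
    using L by (simp add: e_def field_simps power2_eq_square)
qed

text \<open>Adding the previous inequality to its copy with \<open>x\<close> and \<open>y\<close> exchanged gives cocoercivity of
  the gradient, and Cauchy-Schwarz turns this into an \<open>L\<close>-Lipschitz bound. Continuity is what makes
  the estimators of the algorithm measurable.\<close>
lemma continuous_gradient:
  fixes f :: "'v::euclidean_space \<Rightarrow> real"
  assumes convex: "convex_on UNIV f" and smooth: "L_smooth L f"
  shows "continuous_on UNIV (gradient f)"
proof -
  have L: "L > 0"
    using smooth by (simp add: L_smooth_def)
  have "norm (gradient f x - gradient f y) \<le> L * norm (x - y)" for x y
  proof -
    define e where "e = gradient f x - gradient f y"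
    have "2 * (norm e)\<^sup>2 \<le> 2 * L * (e \<bullet> (x - y))"
      using gradient_diff_le_bregman[OF assms, of x y] gradient_diff_le_bregman[OF assms, of y x]
      by (simp add: e_def norm_minus_commute algebra_simps)
    also have "\<dots> \<le> 2 * L * (norm e * norm (x - y))"
      using L by (intro mult_left_mono norm_cauchy_schwarz) auto
    finally have "norm e * norm e \<le> norm e * (L * norm (x - y))"
      by (simp add: power2_eq_square algebra_simps)
    then show ?thesis
      using L unfolding e_def by (cases "e = 0") (auto simp: e_def)
  qed
  then have "L-lipschitz_on UNIV (gradient f)"
    using L by (auto simp: lipschitz_on_def dist_norm)
  then show ?thesis
    by (rule lipschitz_on_continuous_on)
qed

lemma borel_measurable_gradient:
  fixes f :: "'v::euclidean_space \<Rightarrow> real"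
  assumes "convex_on UNIV f" "L_smooth L f"
  shows "gradient f \<in> borel_measurable borel"
  using continuous_gradient[OF assms] by (rule borel_measurable_continuous_onI)

lemma gradient_minimizer:
  fixes f :: "'v::euclidean_space \<Rightarrow> real"
  assumes "is_arg_min f (\<lambda>_. True) x" "f differentiable (at x)"
  shows "gradient f x = 0"
proof -
  have "f x \<le> f y" for y
    using assms(1) by (auto simp: is_arg_min_def not_less)
  then have "(\<lambda>h. h \<bullet> gradient f x) = (\<lambda>h. 0)"
    using gderiv_gradient[OF assms(2)]
    by (intro has_derivative_local_min[of f _ x]) (auto simp: gderiv_def)
  then show ?thesis
    by (metis inner_eq_zero_iff)
qed

section \<open>Empirical variance\<close>

text \<open>The bias-variance decomposition for a uniformly drawn vector \<open>e j\<close>; the next two lemmas drop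
  one of its two parts at \<open>h = 0\<close>.\<close>
lemma sum_norm_sq_centered:
  fixes e :: "nat \<Rightarrow> 'v::real_inner"
  assumes "m \<ge> 1"
  defines "a \<equiv> (1 / real m) *\<^sub>R (\<Sum>j=1..m. e j)"
  shows "(\<Sum>j=1..m. (norm (e j - h))\<^sup>2) = real m * (norm (a - h))\<^sup>2 + (\<Sum>j=1..m. (norm (e j - a))\<^sup>2)"
proof -
  have "(\<Sum>j=1..m. (norm (e j - h))\<^sup>2)
      = (\<Sum>j=1..m. (norm (a - h))\<^sup>2 + (norm (e j - a))\<^sup>2 + 2 * ((e j - a) \<bullet> (a - h)))"
    by (intro sum.cong refl) (simp add: power2_norm_eq_inner algebra_simps inner_commute)
  also have "\<dots> = real m * (norm (a - h))\<^sup>2 + (\<Sum>j=1..m. (norm (e j - a))\<^sup>2)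
      + 2 * ((\<Sum>j=1..m. e j - a) \<bullet> (a - h))"
    by (simp add: sum.distrib inner_sum_left sum_distrib_left)
  also have "(\<Sum>j=1..m. e j - a) = 0"
    using assms(1) by (simp add: sum_subtractf a_def sum_constant_scaleR)
  finally show ?thesis
    by simp
qed

lemma norm_sq_mean_le:
  fixes e :: "nat \<Rightarrow> 'v::real_inner"
  assumes "m \<ge> 1"
  shows "real m * (norm ((1 / real m) *\<^sub>R (\<Sum>j=1..m. e j)))\<^sup>2 \<le> (\<Sum>j=1..m. (norm (e j))\<^sup>2)"
  using sum_norm_sq_centered[OF assms, of e 0] by (simp add: sum_nonneg)

lemma sum_norm_sq_centered_le:
  fixes e :: "nat \<Rightarrow> 'v::real_inner"
  assumes "m \<ge> 1"
  shows "(\<Sum>j=1..m. (norm (e j - (1 / real m) *\<^sub>R (\<Sum>j=1..m. e j)))\<^sup>2) \<le> (\<Sum>j=1..m. (norm (e j))\<^sup>2)"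
  using sum_norm_sq_centered[OF assms, of e 0] by simp

lemma norm_sq_diff_le:
  fixes a b :: "'v::real_inner"
  shows "(norm (a - b))\<^sup>2 \<le> 2 * (norm a)\<^sup>2 + 2 * (norm b)\<^sup>2"
proof -
  have "0 \<le> (norm (a + b))\<^sup>2"
    by simp
  then show ?thesis
    by (simp add: power2_norm_eq_inner inner_add inner_diff inner_commute[of b a])
qed

section \<open>Independence, decoupling and conditional expectation\<close>

lemma norm_sq_sum:
  fixes x :: "'i \<Rightarrow> 'b::real_inner"
  shows "(norm (\<Sum>i\<in>I. x i))\<^sup>2 = (\<Sum>i\<in>I. \<Sum>l\<in>I. x i \<bullet> x l)"
  unfolding power2_norm_eq_inner inner_sum_left inner_sum_right by (rule sum.swap)

context prob_space
begin

text \<open>The identity map into the sample space with a coarser sigma-algebra carries exactly the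
  information of that sigma-algebra. Treating it as a random variable lets the theory of
  independent pairs be used for whole collections of draws of different types, without
  encoding them in one product space.\<close>
lemma indep_var_identity:
  assumes F: "subalgebra M F" and G: "subalgebra M G" and indep: "indep_set (sets F) (sets G)"
  shows "indep_var F (\<lambda>z. z) G (\<lambda>z. z)"
proof -
  have generated: "sigma_sets (space M) {(\<lambda>z. z) -` A \<inter> space M |A. A \<in> sets N} = sets N"
    if "subalgebra M N" for N
  proof -
    have space: "space N = space M"
      using that by (simp add: subalgebra_def)
    then have "{(\<lambda>z. z) -` A \<inter> space M |A. A \<in> sets N} = sets N"
      using sets.sets_into_space[of _ N] by (auto simp: Int_absorb2)
    then show ?thesis
      using sets.sigma_sets_eq[of N] space by simp
  qed
  have "(\<lambda>z. z) \<in> measurable M N" if "subalgebra M N" for N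
    using measurable_from_subalg[OF that measurable_ident] by (simp add: id_def)
  then show ?thesis
    unfolding indep_var_eq generated[OF F] generated[OF G] using assms by blast
qed

text \<open>The joint law of the two identity maps is the product of their laws, so this is Tonelli's
  theorem. It is used with \<open>F\<close> generated by the past and \<open>G\<close> by the current round.\<close>
lemma nn_integral_decouple:
  assumes F: "subalgebra M F" and G: "subalgebra M G" and indep: "indep_set (sets F) (sets G)"
    and \<phi>[measurable]: "\<phi> \<in> borel_measurable (F \<Otimes>\<^sub>M G)"
  shows "(\<integral>\<^sup>+z. \<phi> (z, z) \<partial>M) = (\<integral>\<^sup>+y. \<integral>\<^sup>+z. \<phi> (y, z) \<partial>M \<partial>M)"
proof -
  have idF[measurable]: "(\<lambda>z. z) \<in> measurable M F" and idG[measurable]: "(\<lambda>z. z) \<in> measurable M G"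
    and product: "distr M F (\<lambda>z. z) \<Otimes>\<^sub>M distr M G (\<lambda>z. z) = distr M (F \<Otimes>\<^sub>M G) (\<lambda>z. (z, z))"
    using indep_var_identity[OF F G indep] by (auto simp: indep_var_distribution_eq)
  interpret G: prob_space "distr M G (\<lambda>z. z)"
    by (rule prob_space_distr) (rule idG)
  have "(\<integral>\<^sup>+z. \<phi> (z, z) \<partial>M) = (\<integral>\<^sup>+p. \<phi> p \<partial>distr M (F \<Otimes>\<^sub>M G) (\<lambda>z. (z, z)))"
    by (subst nn_integral_distr) simp_all
  also have "\<dots> = (\<integral>\<^sup>+y. \<integral>\<^sup>+z. \<phi> (y, z) \<partial>distr M G (\<lambda>z. z) \<partial>distr M F (\<lambda>z. z))"
    unfolding product[symmetric] by (rule G.nn_integral_fst[symmetric]) simp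
  also have "\<dots> = (\<integral>\<^sup>+y. \<integral>\<^sup>+z. \<phi> (y, z) \<partial>distr M G (\<lambda>z. z) \<partial>M)"
    by (subst nn_integral_distr) simp_all
  also have "\<dots> = (\<integral>\<^sup>+y. \<integral>\<^sup>+z. \<phi> (y, z) \<partial>M \<partial>M)"
  proof (rule nn_integral_cong)
    fix y assume "y \<in> space M"
    then have "y \<in> space F"
      using F by (simp add: subalgebra_def)
    then have "(\<lambda>z. \<phi> (y, z)) \<in> borel_measurable G"
      using measurable_Pair2[OF \<phi>] by simp
    then show "(\<integral>\<^sup>+z. \<phi> (y, z) \<partial>distr M G (\<lambda>z. z)) = (\<integral>\<^sup>+z. \<phi> (y, z) \<partial>M)"
      by (simp add: nn_integral_distr)
  qed
  finally show ?thesis .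
qed

lemma expectation_mult_indep:
  fixes X Y :: "'a \<Rightarrow> real"
  assumes alg: "subalgebra M F" "subalgebra M G" "indep_set (sets F) (sets G)"
    and meas: "X \<in> borel_measurable F" "Y \<in> borel_measurable G"
    and int: "integrable M X" "integrable M Y"
  shows "integrable M (\<lambda>z. X z * Y z)" "expectation (\<lambda>z. X z * Y z) = expectation X * expectation Y"
proof -
  have "indep_var borel X borel Y"
    using indep_var_compose[OF indep_var_identity[OF alg] meas] by (simp add: comp_def)
  then show "integrable M (\<lambda>z. X z * Y z)" "expectation (\<lambda>z. X z * Y z) = expectation X * expectation Y"
    using int by (auto intro: indep_var_integrable indep_var_lebesgue_integral)
qed

text \<open>The scalar product rule, coordinate by coordinate.\<close>
lemma expectation_inner_indep:
  fixes X Y :: "'a \<Rightarrow> 'b::euclidean_space"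
  assumes alg: "subalgebra M F" "subalgebra M G" "indep_set (sets F) (sets G)"
    and meas: "X \<in> borel_measurable F" "Y \<in> borel_measurable G"
    and int: "integrable M X" "integrable M Y"
  shows "integrable M (\<lambda>z. X z \<bullet> Y z)" "expectation (\<lambda>z. X z \<bullet> Y z) = expectation X \<bullet> expectation Y"
proof -
  have coordinate: "integrable M (\<lambda>z. (X z \<bullet> b) * (Y z \<bullet> b))"
    "expectation (\<lambda>z. (X z \<bullet> b) * (Y z \<bullet> b)) = (expectation X \<bullet> b) * (expectation Y \<bullet> b)" for b
    using expectation_mult_indep[OF alg, of "\<lambda>z. X z \<bullet> b" "\<lambda>z. Y z \<bullet> b"] meas int by simp_all
  have expand: "(\<lambda>z. X z \<bullet> Y z) = (\<lambda>z. \<Sum>b\<in>Basis. (X z \<bullet> b) * (Y z \<bullet> b))"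
    by (rule ext) (rule euclidean_inner)
  show "integrable M (\<lambda>z. X z \<bullet> Y z)"
    unfolding expand by (intro Bochner_Integration.integrable_sum coordinate)
  show "expectation (\<lambda>z. X z \<bullet> Y z) = expectation X \<bullet> expectation Y"
    unfolding expand
    by (simp add: Bochner_Integration.integral_sum coordinate
        euclidean_inner[of "expectation X" "expectation Y"])
qed

lemma integrable_indicator_event: "A \<in> events \<Longrightarrow> integrable M (indicator A :: 'a \<Rightarrow> real)"
  by (rule integrable_real_indicator) (auto simp flip: less_top)

lemma expectation_indicator_indep:
  fixes W :: "'a \<Rightarrow> 'b::euclidean_space"
  assumes alg: "subalgebra M F" "subalgebra M G" "indep_set (sets F) (sets G)"
    and A: "A \<in> sets F" and meas: "W \<in> borel_measurable G" and int: "integrable M W"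
  shows "expectation (\<lambda>z. indicator A z *\<^sub>R W z) = prob A *\<^sub>R expectation W"
proof (rule euclidean_eqI)
  fix b :: 'b
  have A': "A \<in> events"
    using alg(1) A by (auto simp: subalgebra_def)
  have "integrable M (\<lambda>z. indicator A z *\<^sub>R W z)"
    using A' int by (rule integrable_mult_indicator)
  then have "expectation (\<lambda>z. indicator A z *\<^sub>R W z) \<bullet> b
      = expectation (\<lambda>z. indicator A z * (W z \<bullet> b))"
    by (simp flip: integral_inner_left)
  also have "\<dots> = prob A * expectation (\<lambda>z. W z \<bullet> b)"
    using A A' meas int
    by (subst expectation_mult_indep(2)[OF alg]) (auto simp: integrable_indicator_event)
  finally show "expectation (\<lambda>z. indicator A z *\<^sub>R W z) \<bullet> b = (prob A *\<^sub>R expectation W) \<bullet> b"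
    using int by simp
qed

lemma prob_uniform_index:
  assumes "J \<in> measurable M (count_space {1..m})"
    and "distr M (count_space {1..m}) J = uniform_count_measure {1..m::nat}" and "j \<in> {1..m}"
  shows "prob {z \<in> space M. J z = j} = 1 / real m"
proof -
  have "prob {z \<in> space M. J z = j} = measure (distr M (count_space {1..m}) J) {j}"
    using assms(1,3) by (subst measure_distr) (auto intro!: arg_cong[where f = prob])
  also have "\<dots> = 1 / real m"
    unfolding assms(2) using assms(3) by (subst measure_uniform_count_measure) auto
  finally show ?thesis .
qed

text \<open>Splitting the sample space by the value of \<open>J\<close>, each piece is an event of \<open>F\<close>, hence
  independent of \<open>W j\<close>.\<close>
lemma expectation_uniform_index:
  fixes W :: "nat \<Rightarrow> 'a \<Rightarrow> 'b::euclidean_space"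
  assumes alg: "subalgebra M F" "subalgebra M G" "indep_set (sets F) (sets G)"
    and J: "J \<in> measurable F (count_space {1..m})"
      "distr M (count_space {1..m}) J = uniform_count_measure {1..m}"
    and W: "\<And>j. j \<in> {1..m} \<Longrightarrow> W j \<in> borel_measurable G" "\<And>j. j \<in> {1..m} \<Longrightarrow> integrable M (W j)"
  shows "integrable M (\<lambda>z. W (J z) z)"
    "expectation (\<lambda>z. W (J z) z) = (1 / real m) *\<^sub>R (\<Sum>j=1..m. expectation (W j))"
proof -
  define A where "A j = {z \<in> space M. J z = j}" for j
  have J': "J \<in> measurable M (count_space {1..m})"
    using measurable_from_subalg[OF alg(1) J(1)] .
  have A: "A j \<in> sets F" if "j \<in> {1..m}" for j
  proof -
    have "J -` {j} \<inter> space F \<in> sets F"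
      using J(1) that by (intro measurable_sets) auto
    moreover have "J -` {j} \<inter> space F = A j"
      using alg(1) by (auto simp: A_def subalgebra_def)
    ultimately show ?thesis
      by simp
  qed
  have A': "A j \<in> events" if "j \<in> {1..m}" for j
    using A[OF that] alg(1) by (auto simp: subalgebra_def)
  have int: "integrable M (\<lambda>z. indicator (A j) z *\<^sub>R W j z)" if "j \<in> {1..m}" for j
    using A'[OF that] W(2)[OF that] by (rule integrable_mult_indicator)
  have split: "W (J z) z = (\<Sum>j=1..m. indicator (A j) z *\<^sub>R W j z)" if z: "z \<in> space M" for z
  proof -
    have "J z \<in> {1..m}"
      using measurable_space[OF J' z] by simp
    then have "W (J z) z = (\<Sum>j=1..m. if j = J z then W j z else 0)"
      by (simp add: sum.delta)
    also have "\<dots> = (\<Sum>j=1..m. indicator (A j) z *\<^sub>R W j z)"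
      using z by (intro sum.cong) (auto simp: A_def)
    finally show ?thesis .
  qed
  have cong: "integrable M (\<lambda>z. W (J z) z) = integrable M (\<lambda>z. \<Sum>j=1..m. indicator (A j) z *\<^sub>R W j z)"
    "expectation (\<lambda>z. W (J z) z) = expectation (\<lambda>z. \<Sum>j=1..m. indicator (A j) z *\<^sub>R W j z)"
    by (rule Bochner_Integration.integrable_cong[OF refl split] Bochner_Integration.integral_cong[OF refl split]; assumption)+
  show "integrable M (\<lambda>z. W (J z) z)"
    unfolding cong by (intro Bochner_Integration.integrable_sum int)
  have "expectation (\<lambda>z. W (J z) z) = (\<Sum>j=1..m. expectation (\<lambda>z. indicator (A j) z *\<^sub>R W j z))"
    unfolding cong by (intro Bochner_Integration.integral_sum int)
  also have "\<dots> = (\<Sum>j=1..m. (1 / real m) *\<^sub>R expectation (W j))"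
    using prob_uniform_index[OF J' J(2)]
    by (intro sum.cong refl) (simp add: expectation_indicator_indep[OF alg A W] flip: A_def)
  finally show "expectation (\<lambda>z. W (J z) z) = (1 / real m) *\<^sub>R (\<Sum>j=1..m. expectation (W j))"
    by (simp add: scaleR_sum_right)
qed

lemma expectation_norm_sq_affine:
  fixes X :: "'a \<Rightarrow> 'b::euclidean_space"
  assumes "integrable M X" "integrable M (\<lambda>z. (norm (X z))\<^sup>2)"
  shows "integrable M (\<lambda>z. (norm (w + r *\<^sub>R X z))\<^sup>2)"
    "expectation (\<lambda>z. (norm (w + r *\<^sub>R X z))\<^sup>2)
      = (norm w)\<^sup>2 + 2 * r * (w \<bullet> expectation X) + r\<^sup>2 * expectation (\<lambda>z. (norm (X z))\<^sup>2)"
proof -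
  have expand: "(\<lambda>z. (norm (w + r *\<^sub>R X z))\<^sup>2) = (\<lambda>z. (norm w)\<^sup>2 + 2 * r * (w \<bullet> X z) + r\<^sup>2 * (norm (X z))\<^sup>2)"
  proof (rule ext)
    fix z
    show "(norm (w + r *\<^sub>R X z))\<^sup>2 = (norm w)\<^sup>2 + 2 * r * (w \<bullet> X z) + r\<^sup>2 * (norm (X z))\<^sup>2"
      unfolding power2_norm_eq_inner
      by (simp add: inner_add inner_commute[of "X z" w] power2_eq_square distrib_left)
  qed
  show "integrable M (\<lambda>z. (norm (w + r *\<^sub>R X z))\<^sup>2)"
    unfolding expand using assms by simp
  show "expectation (\<lambda>z. (norm (w + r *\<^sub>R X z))\<^sup>2)
      = (norm w)\<^sup>2 + 2 * r * (w \<bullet> expectation X) + r\<^sup>2 * expectation (\<lambda>z. (norm (X z))\<^sup>2)"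
    unfolding expand using assms by (simp add: prob_space)
qed

text \<open>Expanding the square, the off-diagonal terms are those of the norm of the summed means, and
  only the diagonal adds variance. This is the source of the factor \<open>1 / n\<close> gained by averaging over
  the workers.\<close>
lemma expectation_norm_sq_sum_uncorrelated:
  fixes X :: "'i \<Rightarrow> 'a \<Rightarrow> 'b::euclidean_space"
  assumes fin: "finite I"
    and sq: "\<And>i. i \<in> I \<Longrightarrow> integrable M (\<lambda>z. (norm (X i z))\<^sup>2)"
    and cross: "\<And>i l. i \<in> I \<Longrightarrow> l \<in> I \<Longrightarrow> i \<noteq> l \<Longrightarrow> integrable M (\<lambda>z. X i z \<bullet> X l z)"
      "\<And>i l. i \<in> I \<Longrightarrow> l \<in> I \<Longrightarrow> i \<noteq> l \<Longrightarrow> expectation (\<lambda>z. X i z \<bullet> X l z) = a i \<bullet> a l"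
  shows "integrable M (\<lambda>z. (norm (\<Sum>i\<in>I. X i z))\<^sup>2)"
    "expectation (\<lambda>z. (norm (\<Sum>i\<in>I. X i z))\<^sup>2)
      = (norm (\<Sum>i\<in>I. a i))\<^sup>2 + (\<Sum>i\<in>I. expectation (\<lambda>z. (norm (X i z))\<^sup>2) - (norm (a i))\<^sup>2)"
proof -
  define v where "v i = expectation (\<lambda>z. (norm (X i z))\<^sup>2) - (norm (a i))\<^sup>2" for i
  have int: "integrable M (\<lambda>z. X i z \<bullet> X l z)" if "i \<in> I" "l \<in> I" for i l
    using that cross(1)[of i l] sq[of i] by (cases "i = l") (auto simp: power2_norm_eq_inner)
  have exp: "expectation (\<lambda>z. X i z \<bullet> X l z) = a i \<bullet> a l + (if l = i then v i else 0)"
    if "i \<in> I" "l \<in> I" for i l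
    using that cross(2)[of i l] by (auto simp: v_def power2_norm_eq_inner)
  have expand: "(\<lambda>z. (norm (\<Sum>i\<in>I. X i z))\<^sup>2) = (\<lambda>z. \<Sum>i\<in>I. \<Sum>l\<in>I. X i z \<bullet> X l z)"
    by (simp add: norm_sq_sum)
  show "integrable M (\<lambda>z. (norm (\<Sum>i\<in>I. X i z))\<^sup>2)"
    unfolding expand by (intro Bochner_Integration.integrable_sum int)
  have "expectation (\<lambda>z. (norm (\<Sum>i\<in>I. X i z))\<^sup>2) = (\<Sum>i\<in>I. \<Sum>l\<in>I. expectation (\<lambda>z. X i z \<bullet> X l z))"
    unfolding expand by (simp add: Bochner_Integration.integral_sum int)
  also have "\<dots> = (\<Sum>i\<in>I. \<Sum>l\<in>I. a i \<bullet> a l) + (\<Sum>i\<in>I. v i)"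
    using fin by (simp add: exp sum.distrib)
  also have "(\<Sum>i\<in>I. \<Sum>l\<in>I. a i \<bullet> a l) = (norm (\<Sum>i\<in>I. a i))\<^sup>2"
    by (simp add: norm_sq_sum)
  finally show "expectation (\<lambda>z. (norm (\<Sum>i\<in>I. X i z))\<^sup>2)
      = (norm (\<Sum>i\<in>I. a i))\<^sup>2 + (\<Sum>i\<in>I. expectation (\<lambda>z. (norm (X i z))\<^sup>2) - (norm (a i))\<^sup>2)"
    by (simp add: v_def)
qed

lemma expectation_if_event:
  assumes "{z \<in> space M. P z} \<in> events" and "prob {z \<in> space M. P z} = p"
  shows "integrable M (\<lambda>z. if P z then s else t :: real)"
    "expectation (\<lambda>z. if P z then s else t) = p * s + (1 - p) * t"
proof -
  let ?A = "{z \<in> space M. P z}"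
  have eq: "(if P z then s else t) = t + indicator ?A z * (s - t)" if "z \<in> space M" for z
    using that by simp
  have int: "integrable M (\<lambda>z. indicator ?A z * (s - t))"
    using assms(1) by (intro integrable_mult_left integrable_indicator_event)
  have cong: "integrable M (\<lambda>z. if P z then s else t) = integrable M (\<lambda>z. t + indicator ?A z * (s - t))"
    "expectation (\<lambda>z. if P z then s else t) = expectation (\<lambda>z. t + indicator ?A z * (s - t))"
    by (rule Bochner_Integration.integrable_cong[OF refl eq] Bochner_Integration.integral_cong[OF refl eq]; assumption)+
  show "integrable M (\<lambda>z. if P z then s else t)"
    unfolding cong using int by simp
  have "expectation (\<lambda>z. t + indicator ?A z * (s - t)) = t + p * (s - t)"
    using int assms by (subst Bochner_Integration.integral_add) (simp_all add: prob_space)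
  then show "expectation (\<lambda>z. if P z then s else t) = p * s + (1 - p) * t"
    unfolding cong by (simp add: algebra_simps)
qed

text \<open>The event that the conditional expectation exceeds \<open>g\<close> belongs to \<open>F\<close>, so the excess has a
  nonpositive integral over it. Being positive there, the excess lives on a null set.\<close>
lemma real_cond_exp_le:
  assumes F: "subalgebra M F" and f: "integrable M f"
    and g: "integrable M g" "g \<in> borel_measurable F"
    and le: "\<And>A. A \<in> sets F \<Longrightarrow> (\<integral>z\<in>A. f z \<partial>M) \<le> (\<integral>z\<in>A. g z \<partial>M)"
  shows "AE z in M. real_cond_exp M F f z \<le> g z"
proof -
  interpret finite_measure_subalgebra M F
    by unfold_locales (rule F)
  define e where "e z = real_cond_exp M F f z - g z" for z
  define A where "A = {z \<in> space F. 0 < e z}"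
  have e: "integrable M e" "e \<in> borel_measurable F"
    unfolding e_def using f g by auto
  then have A: "A \<in> sets F"
    unfolding A_def by measurable
  then have A': "A \<in> sets M" and space: "space F = space M"
    using F by (auto simp: subalgebra_def)
  have sint: "set_integrable M A h" if "integrable M h" for h :: "'a \<Rightarrow> real"
    unfolding set_integrable_def using A' that by (rule integrable_mult_indicator)
  have "(\<integral>z\<in>A. e z \<partial>M) = (\<integral>z\<in>A. f z \<partial>M) - (\<integral>z\<in>A. g z \<partial>M)"
    unfolding e_def using f g A
    by (subst set_integral_diff(2)) (auto intro!: sint simp: real_cond_exp_intA[symmetric])
  also have "\<dots> \<le> 0"
    using le[OF A] by simp
  finally have "(\<integral>z. indicator A z *\<^sub>R e z \<partial>M) \<le> 0"
    by (simp add: set_lebesgue_integral_def)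
  moreover have nonneg: "AE z in M. 0 \<le> indicator A z *\<^sub>R e z"
    by (auto simp: A_def indicator_def)
  ultimately have "(\<integral>z. indicator A z *\<^sub>R e z \<partial>M) = 0"
    using integral_nonneg_AE[OF nonneg] by linarith
  then have "AE z in M. indicator A z *\<^sub>R e z = 0"
    using integral_nonneg_eq_0_iff_AE[OF _ nonneg] sint[OF e(1)] by (simp add: set_integrable_def)
  then show ?thesis
    using AE_space
  proof eventually_elim
    case (elim z)
    then show ?case
      by (cases "0 < e z") (auto simp: A_def e_def space)
  qed
qed

end

section \<open>Measurability of the state\<close>

text \<open>Only the entries with indices in range are constrained: for all other indices the draws, and
  with them the entries of the state, are arbitrary functions of the outcome.\<close>
definition state_measurable ::
    "nat \<Rightarrow> nat \<Rightarrow> 'a measure \<Rightarrow> ('a \<Rightarrow> 'v::euclidean_space vr_state) \<Rightarrow> bool" where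
  "state_measurable n m A X \<longleftrightarrow>
     (\<lambda>z. st_x (X z)) \<in> borel_measurable A \<and>
     (\<forall>i\<in>{1..n}. (\<lambda>z. st_h (X z) i) \<in> borel_measurable A) \<and>
     (\<forall>i\<in>{1..n}. \<forall>j\<in>{1..m}. (\<lambda>z. st_w (X z) i j) \<in> borel_measurable A)"

lemma state_measurable_compose:
  assumes "state_measurable n m A X" and "g \<in> measurable B A"
  shows "state_measurable n m B (\<lambda>z. X (g z))"
  using assms(1) unfolding state_measurable_def by (auto intro: measurable_compose[OF assms(2)])

lemma state_measurable_state_algebra: "state_measurable n m (state_algebra M n m X) X"
proof -
  define N where "N = (borel \<Otimes>\<^sub>M PiM {1..n} (\<lambda>_. borel) \<Otimes>\<^sub>M PiM ({1..n} \<times> {1..m}) (\<lambda>_. borel)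
    :: ('b \<times> (nat \<Rightarrow> 'b) \<times> (nat \<times> nat \<Rightarrow> 'b)) measure)"
  define T where "T z = (st_x (X z), restrict (st_h (X z)) {1..n},
    restrict (\<lambda>(i, j). st_w (X z) i j) ({1..n} \<times> {1..m}))" for z
  have T: "T \<in> measurable (state_algebra M n m X) N"
    unfolding state_algebra_def T_def[abs_def] N_def
    by (rule measurable_vimage_algebra1) (auto simp: space_pair_measure space_PiM)
  have "(\<lambda>t. fst t) \<in> borel_measurable N"
    unfolding N_def by measurable
  from measurable_compose[OF T this] have x: "(\<lambda>z. st_x (X z)) \<in> borel_measurable (state_algebra M n m X)"
    by (simp add: T_def)
  have h: "(\<lambda>z. st_h (X z) i) \<in> borel_measurable (state_algebra M n m X)" if i: "i \<in> {1..n}" for i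
  proof -
    have "(\<lambda>t. fst (snd t) i) \<in> borel_measurable N"
      unfolding N_def using i by measurable
    from measurable_compose[OF T this] show ?thesis
      using i by (simp add: T_def)
  qed
  have w: "(\<lambda>z. st_w (X z) i j) \<in> borel_measurable (state_algebra M n m X)"
    if ij: "i \<in> {1..n}" "j \<in> {1..m}" for i j
  proof -
    have "(\<lambda>t. snd (snd t) (i, j)) \<in> borel_measurable N"
      unfolding N_def using ij
      by (intro measurable_compose[OF measurable_compose[OF measurable_snd measurable_snd]
            measurable_component_singleton]) auto
    from measurable_compose[OF T this] show ?thesis
      using ij by (simp add: T_def)
  qed
  show ?thesis
    using x h w by (simp add: state_measurable_def)
qed

lemma subalgebra_state_algebra:
  assumes "state_measurable n m A X" and "space A = space M"
  shows "subalgebra A (state_algebra M n m X)"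
  unfolding subalgebra_def
proof
  show "space (state_algebra M n m X) = space A"
    by (simp add: state_algebra_def assms(2))
  have "(\<lambda>z. (st_x (X z), restrict (st_h (X z)) {1..n},
      restrict (\<lambda>(i, j). st_w (X z) i j) ({1..n} \<times> {1..m})))
    \<in> measurable A (borel \<Otimes>\<^sub>M PiM {1..n} (\<lambda>_. borel) \<Otimes>\<^sub>M PiM ({1..n} \<times> {1..m}) (\<lambda>_. borel))"
    using assms(1) unfolding state_measurable_def
    by (intro measurable_Pair measurable_restrict) auto
  then show "sets (state_algebra M n m X) \<subseteq> sets A"
    unfolding state_algebra_def assms(2)[symmetric] sets_vimage_algebra
    by (intro sets.sigma_sets_subset) (auto intro: measurable_sets)
qed

lemma measurable_lyapunov:
  fixes f :: "nat \<Rightarrow> nat \<Rightarrow> 'v::euclidean_space \<Rightarrow> real"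
  assumes grad: "\<And>i j. i \<in> {1..n} \<Longrightarrow> j \<in> {1..m} \<Longrightarrow> gradient (f i j) \<in> borel_measurable borel"
    and X: "state_measurable n m A X"
  shows "(\<lambda>z. lyapunov n m f xs b c \<gamma> (X z)) \<in> borel_measurable A"
proof -
  have [measurable]: "(\<lambda>z. st_x (X z)) \<in> borel_measurable A"
    using X by (simp add: state_measurable_def)
  have "(\<lambda>z. (norm (st_h (X z) i - gradient (worker_objective m f i) xs))\<^sup>2) \<in> borel_measurable A"
    if "i \<in> {1..n}" for i
  proof -
    have [measurable]: "(\<lambda>z. st_h (X z) i) \<in> borel_measurable A"
      using X that by (simp add: state_measurable_def)
    show ?thesis
      by measurable
  qed
  then have [measurable]: "(\<lambda>z. H_term n m f xs (X z)) \<in> borel_measurable A"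
    unfolding H_term_def by (intro borel_measurable_sum)
  have "(\<lambda>z. (norm (gradient (f i j) (st_w (X z) i j) - gradient (f i j) xs))\<^sup>2) \<in> borel_measurable A"
    if "i \<in> {1..n}" "j \<in> {1..m}" for i j
  proof -
    have "(\<lambda>z. st_w (X z) i j) \<in> borel_measurable A"
      using X that by (simp add: state_measurable_def)
    then have [measurable]: "(\<lambda>z. gradient (f i j) (st_w (X z) i j)) \<in> borel_measurable A"
      using grad[OF that] by (rule measurable_compose)
    show ?thesis
      by measurable
  qed
  then have [measurable]: "(\<lambda>z. D_term n m f xs (X z)) \<in> borel_measurable A"
    unfolding D_term_def by (intro borel_measurable_sum)
  show ?thesis
    unfolding lyapunov_def by measurable
qed

lemma measurable_vr_delta:
  fixes f :: "nat \<Rightarrow> nat \<Rightarrow> 'v::euclidean_space \<Rightarrow> real"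
  assumes grad: "\<And>i j. i \<in> {1..n} \<Longrightarrow> j \<in> {1..m} \<Longrightarrow> gradient (f i j) \<in> borel_measurable borel"
    and Q: "(\<lambda>(s, x). Q s x) \<in> borel_measurable (R \<Otimes>\<^sub>M borel)"
    and X: "state_measurable n m A X" and i: "i \<in> {1..n}"
    and J: "(\<lambda>z. J z i) \<in> measurable A (count_space {1..m})"
    and S: "(\<lambda>z. S z i) \<in> measurable A R"
  shows "(\<lambda>z. vr_delta m f Q (J z) (S z) (X z) i) \<in> borel_measurable A"
proof -
  have h: "(\<lambda>z. st_h (X z) i) \<in> borel_measurable A"
    and x: "(\<lambda>z. st_x (X z)) \<in> borel_measurable A"
    using X i by (simp_all add: state_measurable_def)
  have w: "(\<lambda>z. gradient (f i j) (st_w (X z) i j)) \<in> borel_measurable A" if "j \<in> {1..m}" for j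
    using X i that by (intro measurable_compose[OF _ grad]) (simp_all add: state_measurable_def)
  have "(\<lambda>z. vr_estimator m f (X z) i j - st_h (X z) i) \<in> borel_measurable A" if "j \<in> {1..m}" for j
    unfolding vr_estimator_def using that i
    by (intro borel_measurable_diff borel_measurable_add borel_measurable_scaleR
        borel_measurable_const borel_measurable_sum w h measurable_compose[OF x grad]) auto
  then have "(\<lambda>z. vr_estimator m f (X z) i (J z i) - st_h (X z) i) \<in> borel_measurable A"
    by (rule measurable_compose_countable'[OF _ J]) auto
  with S have "(\<lambda>z. (S z i, vr_estimator m f (X z) i (J z i) - st_h (X z) i)) \<in> measurable A (R \<Otimes>\<^sub>M borel)"
    by (rule measurable_Pair)
  from measurable_compose[OF this Q] show ?thesis
    by (simp add: vr_delta_def)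
qed

lemma state_measurable_step:
  fixes f :: "nat \<Rightarrow> nat \<Rightarrow> 'v::euclidean_space \<Rightarrow> real"
  assumes grad: "\<And>i j. i \<in> {1..n} \<Longrightarrow> j \<in> {1..m} \<Longrightarrow> gradient (f i j) \<in> borel_measurable borel"
    and Q: "(\<lambda>(s, x). Q s x) \<in> borel_measurable (R \<Otimes>\<^sub>M borel)"
    and X: "state_measurable n m A X"
    and U: "v = L_SVRG \<Longrightarrow> U \<in> measurable A (count_space UNIV)"
    and J: "\<And>i. i \<in> {1..n} \<Longrightarrow> (\<lambda>z. J z i) \<in> measurable A (count_space {1..m})"
    and S: "\<And>i. i \<in> {1..n} \<Longrightarrow> (\<lambda>z. S z i) \<in> measurable A R"
  shows "state_measurable n m A (\<lambda>z. vr_diana_step v n m f Q \<alpha> \<gamma> (U z) (J z) (S z) (X z))"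
  unfolding state_measurable_def vr_diana_step_def vr_state.simps
proof (intro conjI ballI)
  have h: "(\<lambda>z. st_h (X z) i) \<in> borel_measurable A" if "i \<in> {1..n}" for i
    using X that by (simp add: state_measurable_def)
  have x: "(\<lambda>z. st_x (X z)) \<in> borel_measurable A"
    using X by (simp add: state_measurable_def)
  have delta: "(\<lambda>z. vr_delta m f Q (J z) (S z) (X z) i) \<in> borel_measurable A" if "i \<in> {1..n}" for i
    using measurable_vr_delta[where J = J and S = S, OF grad Q X that J[OF that] S[OF that]] .
  show "(\<lambda>z. st_x (X z) - \<gamma> *\<^sub>R (1 / real n) *\<^sub>R (\<Sum>i=1..n. vr_delta m f Q (J z) (S z) (X z) i + st_h (X z) i))
      \<in> borel_measurable A"
    by (intro borel_measurable_diff borel_measurable_add borel_measurable_scaleR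
        borel_measurable_const borel_measurable_sum delta h x)
  fix i assume i: "i \<in> {1..n}"
  show "(\<lambda>z. st_h (X z) i + \<alpha> *\<^sub>R vr_delta m f Q (J z) (S z) (X z) i) \<in> borel_measurable A"
    by (intro borel_measurable_add borel_measurable_scaleR borel_measurable_const delta h i)
  fix j assume j: "j \<in> {1..m}"
  have w: "(\<lambda>z. st_w (X z) i j) \<in> borel_measurable A"
    using X i j by (simp add: state_measurable_def)
  have "Measurable.pred A (\<lambda>z. case v of L_SVRG \<Rightarrow> U z | SAGA \<Rightarrow> j = J z i)"
  proof (cases v)
    case L_SVRG
    then show ?thesis
      using U by simp
  next
    case SAGA
    have "(\<lambda>z. j = J z i) = (\<lambda>l. j = l) \<circ> (\<lambda>z. J z i)"
      by (simp add: comp_def)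
    then show ?thesis
      using SAGA measurable_comp[OF J[OF i], of "\<lambda>l. j = l" "count_space UNIV"] by simp
  qed
  then show "(\<lambda>z. if case v of L_SVRG \<Rightarrow> U z | SAGA \<Rightarrow> j = J z i then st_x (X z) else st_w (X z) i j)
      \<in> borel_measurable A"
    using x w by (intro measurable_If) (simp_all add: pred_def)
qed

section \<open>The algorithm and the information carried by its draws\<close>

lemma sets_vimage_algebra_Pow: "sets (vimage_algebra \<Omega> X N) \<subseteq> Pow \<Omega>"
  using sets.space_closed[of "vimage_algebra \<Omega> X N"] by simp

lemma measurable_if_vimage_algebra:
  assumes "sets (vimage_algebra \<Omega> X N) \<subseteq> sets A" "space A = \<Omega>" "X \<in> \<Omega> \<rightarrow> space N"
  shows "X \<in> measurable A N"
  using assms in_vimage_algebra[of _ N X \<Omega>] by (intro measurableI) auto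

text \<open>The sigma-algebras of the past and of the current round are generated by the draws with
  smaller and with equal round number.\<close>
fun draw_round :: "draw \<Rightarrow> nat" where
  "draw_round (Coin k) = k"
| "draw_round (Index k i) = k"
| "draw_round (Seed k i) = k"

text \<open>The hypotheses under which the contraction holds. The rate enters only through its three upper
  bounds, one for each part of the Lyapunov function.\<close>
locale vr_diana_setting =
  fixes f :: "nat \<Rightarrow> nat \<Rightarrow> 'v::euclidean_space \<Rightarrow> real"
    and n m :: nat
    and L \<mu> \<omega> \<alpha> \<gamma> b c \<rho> :: real
    and xs :: 'v
    and R :: "'r measure"
    and Q :: "'r \<Rightarrow> 'v \<Rightarrow> 'v"
    and v :: variant
    and M :: "'a measure"
    and U :: "nat \<Rightarrow> 'a \<Rightarrow> bool"
    and J :: "nat \<Rightarrow> nat \<Rightarrow> 'a \<Rightarrow> nat"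
    and S :: "nat \<Rightarrow> nat \<Rightarrow> 'a \<Rightarrow> 'r"
  assumes n_pos: "n \<ge> 1" and m_pos: "m \<ge> 1"
    and f_convex: "i \<in> {1..n} \<Longrightarrow> j \<in> {1..m} \<Longrightarrow> convex_on UNIV (f i j)"
    and f_smooth: "i \<in> {1..n} \<Longrightarrow> j \<in> {1..m} \<Longrightarrow> L_smooth L (f i j)"
    and worker_strongly_convex: "i \<in> {1..n} \<Longrightarrow> strongly_convex \<mu> (worker_objective m f i)"
    and minimizer: "is_arg_min (objective n m f) (\<lambda>_. True) xs"
    and quantization: "quantization_operator \<omega> R Q"
    and \<alpha>_pos: "0 < \<alpha>" and \<alpha>_le: "\<alpha> \<le> 1 / (\<omega> + 1)"
    and \<gamma>_def: "\<gamma> = 1 / (L * (1 + 36 * (\<omega> + 1) / real n))"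
    and b_def: "b = 4 * (\<omega> + 1) / (\<alpha> * (real n)\<^sup>2)"
    and c_def: "c = 16 * (\<omega> + 1) / (real n)\<^sup>2"
    and \<rho>_le: "\<rho> \<le> \<gamma> * \<mu>" "\<rho> \<le> \<alpha> / 2" "\<rho> \<le> 3 / (8 * real m)"
    and draws: "vr_diana_draws v n m M R U J S"
begin

sublocale prob_space M
  using draws by (simp add: vr_diana_draws_def)

definition draw_algebra :: "draw set \<Rightarrow> 'a measure" where
  "draw_algebra D = sigma (space M) (\<Union>d\<in>D. draw_sets M R U J S d)"

definition past_draws :: "nat \<Rightarrow> draw set" where
  "past_draws k = {d \<in> draws_of v n. draw_round d < k}"

definition current_draws :: "nat \<Rightarrow> draw set" where
  "current_draws k = {d \<in> draws_of v n. draw_round d = k}"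

lemma draw_sets_Pow: "draw_sets M R U J S d \<subseteq> Pow (space M)"
  by (cases d) (simp_all add: sets_vimage_algebra_Pow)

lemma Int_stable_draw_sets: "Int_stable (draw_sets M R U J S d)"
  by (cases d) (auto intro: sets.Int_stable)

lemma space_draw_algebra [simp]: "space (draw_algebra D) = space M"
  unfolding draw_algebra_def by (rule space_measure_of) (use draw_sets_Pow in blast)

lemma sets_draw_algebra:
  "sets (draw_algebra D) = sigma_sets (space M) (\<Union>d\<in>D. draw_sets M R U J S d)"
  unfolding draw_algebra_def by (rule sets_measure_of) (use draw_sets_Pow in blast)

lemma draw_algebra_mono: "D \<subseteq> E \<Longrightarrow> subalgebra (draw_algebra E) (draw_algebra D)"
  unfolding subalgebra_def sets_draw_algebra by (auto intro!: sigma_sets_subseteq)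

lemma indep_draw_sets: "indep_sets (draw_sets M R U J S) (draws_of v n)"
  using draws by (simp add: vr_diana_draws_def)

lemma subalgebra_draw_algebra:
  assumes "D \<subseteq> draws_of v n"
  shows "subalgebra M (draw_algebra D)"
proof -
  have "(\<Union>d\<in>D. draw_sets M R U J S d) \<subseteq> events"
    using indep_draw_sets assms by (auto simp: indep_sets_def)
  then show ?thesis
    unfolding subalgebra_def sets_draw_algebra by (auto dest!: sets.sigma_sets_subset)
qed

text \<open>Grouping independent families: each \<open>draw_sets\<close> is a sigma-algebra, hence stable under
  intersection, so disjoint groups of draws generate independent sigma-algebras.\<close>
lemma indep_draw_algebras:
  assumes "D \<subseteq> draws_of v n" "E \<subseteq> draws_of v n" "D \<inter> E = {}"
  shows "indep_set (sets (draw_algebra D)) (sets (draw_algebra E))"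
proof -
  have "indep_sets (draw_sets M R U J S) (\<Union>s\<in>UNIV. case_bool D E s)"
    using assms by (intro indep_sets_mono_index[OF _ indep_draw_sets]) (auto simp: UNIV_bool)
  moreover have "disjoint_family_on (case_bool D E) UNIV"
    using assms(3) by (auto simp: disjoint_family_on_def UNIV_bool)
  ultimately have "indep_sets (\<lambda>s. sigma_sets (space M) (\<Union>d\<in>case_bool D E s. draw_sets M R U J S d)) UNIV"
    by (intro indep_sets_collect_sigma Int_stable_draw_sets)
  then show ?thesis
    unfolding indep_set_def
    by (rule indep_sets_mono_sets) (auto simp: sets_draw_algebra split: bool.split)
qed

lemma past_draws_subset: "past_draws k \<subseteq> draws_of v n"
  and current_draws_subset: "current_draws k \<subseteq> draws_of v n"
  by (auto simp: past_draws_def current_draws_def)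

lemma past_current_disjoint: "past_draws k \<inter> current_draws k = {}"
  by (auto simp: past_draws_def current_draws_def)

lemma measurable_coin:
  assumes "Coin k \<in> D"
  shows "U k \<in> measurable (draw_algebra D) (count_space UNIV)"
proof (rule measurable_if_vimage_algebra)
  show "sets (vimage_algebra (space M) (U k) (count_space UNIV)) \<subseteq> sets (draw_algebra D)"
    unfolding sets_draw_algebra using assms by (force intro!: sigma_sets.Basic)
qed auto

lemma measurable_index:
  assumes "Index k i \<in> D" "i \<in> {1..n}"
  shows "J k i \<in> measurable (draw_algebra D) (count_space {1..m})"
proof (rule measurable_if_vimage_algebra)
  have "sets (vimage_algebra (space M) (J k i) (count_space {1..m}))
      \<subseteq> sets (vimage_algebra (space M) (J k i) (count_space UNIV))"
    unfolding sets_vimage_algebra by (intro sigma_sets_mono') auto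
  also have "\<dots> \<subseteq> sets (draw_algebra D)"
    unfolding sets_draw_algebra using assms by (force intro!: sigma_sets.Basic)
  finally show "sets (vimage_algebra (space M) (J k i) (count_space {1..m})) \<subseteq> sets (draw_algebra D)" .
  have "J k i \<in> measurable M (count_space {1..m})"
    using draws assms(2) by (simp add: vr_diana_draws_def)
  then show "J k i \<in> space M \<rightarrow> space (count_space {1..m})"
    by (auto dest: measurable_space)
qed auto

lemma measurable_seed:
  assumes "Seed k i \<in> D" "i \<in> {1..n}"
  shows "S k i \<in> measurable (draw_algebra D) R"
proof (rule measurable_if_vimage_algebra)
  show "sets (vimage_algebra (space M) (S k i) R) \<subseteq> sets (draw_algebra D)"
    unfolding sets_draw_algebra using assms by (force intro!: sigma_sets.Basic)
  have "S k i \<in> measurable M R"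
    using draws assms(2) by (simp add: vr_diana_draws_def)
  then show "S k i \<in> space M \<rightarrow> space R"
    by (auto dest: measurable_space)
qed auto

section \<open>The objective and its optimality gap\<close>

lemma L_pos: "L > 0"
  using f_smooth[of 1 1] n_pos m_pos by (simp add: L_smooth_def)

lemma \<omega>_nonneg: "\<omega> \<ge> 0"
  using quantization by (simp add: quantization_operator_def)

lemma measurable_gradient: "i \<in> {1..n} \<Longrightarrow> j \<in> {1..m} \<Longrightarrow> gradient (f i j) \<in> borel_measurable borel"
  using f_convex f_smooth by (rule borel_measurable_gradient)

lemma gderiv_worker_objective:
  assumes "i \<in> {1..n}"
  shows "GDERIV (worker_objective m f i) x :> (1 / real m) *\<^sub>R (\<Sum>j=1..m. gradient (f i j) x)"
  unfolding worker_objective_def[abs_def]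
  using f_smooth[OF assms] by (intro gderiv_scaled_sum gderiv_gradient) (auto simp: L_smooth_def)

lemma gradient_worker_objective:
  "i \<in> {1..n} \<Longrightarrow> gradient (worker_objective m f i) x = (1 / real m) *\<^sub>R (\<Sum>j=1..m. gradient (f i j) x)"
  by (rule gradient_unique) (rule gderiv_worker_objective)

lemma gderiv_objective:
  "GDERIV (objective n m f) x :> (1 / real n) *\<^sub>R (\<Sum>i=1..n. gradient (worker_objective m f i) x)"
  unfolding objective_def[abs_def] using gderiv_worker_objective
  by (intro gderiv_scaled_sum gderiv_gradient) (auto intro: differentiable_gderiv)

lemma gradient_objective:
  "gradient (objective n m f) x = (1 / real n) *\<^sub>R (\<Sum>i=1..n. gradient (worker_objective m f i) x)"
  by (rule gradient_unique) (rule gderiv_objective)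

lemma sum_worker_gradients_minimizer: "(\<Sum>i=1..n. gradient (worker_objective m f i) xs) = 0"
proof -
  have "gradient (objective n m f) xs = 0"
    using minimizer gderiv_objective by (intro gradient_minimizer differentiable_gderiv)
  then show ?thesis
    using n_pos by (simp add: gradient_objective)
qed

definition gap :: "'v \<Rightarrow> real" where
  "gap x = objective n m f x - objective n m f xs"

definition deviation :: "'v \<Rightarrow> real" where
  "deviation x = (\<Sum>i=1..n. \<Sum>j=1..m. (norm (gradient (f i j) x - gradient (f i j) xs))\<^sup>2)"

text \<open>Summing the Bregman bounds over all components, the linear terms add up to the gradient of
  the objective at the minimizer, which is zero.\<close>
lemma deviation_le_gap: "deviation x \<le> 2 * L * real n * real m * gap x"
proof -
  have inner: "(\<Sum>j=1..m. gradient (f i j) xs \<bullet> (x - xs)) = real m * (gradient (worker_objective m f i) xs \<bullet> (x - xs))"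
    if "i \<in> {1..n}" for i
    using that m_pos by (simp add: gradient_worker_objective inner_sum_left)
  have total: "(\<Sum>i=1..n. \<Sum>j=1..m. f i j y) = real n * real m * objective n m f y" for y
    using n_pos m_pos by (simp add: objective_def worker_objective_def sum_distrib_left)
  have "deviation x \<le> (\<Sum>i=1..n. \<Sum>j=1..m. 2 * L * (f i j x - f i j xs - gradient (f i j) xs \<bullet> (x - xs)))"
    unfolding deviation_def by (intro sum_mono gradient_diff_le_bregman f_convex f_smooth)
  also have "\<dots> = 2 * L * ((\<Sum>i=1..n. \<Sum>j=1..m. f i j x) - (\<Sum>i=1..n. \<Sum>j=1..m. f i j xs)
      - (\<Sum>i=1..n. \<Sum>j=1..m. gradient (f i j) xs \<bullet> (x - xs)))"
    by (simp only: sum_subtractf sum_distrib_left[symmetric])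
  also have "(\<Sum>i=1..n. \<Sum>j=1..m. gradient (f i j) xs \<bullet> (x - xs))
      = real m * ((\<Sum>i=1..n. gradient (worker_objective m f i) xs) \<bullet> (x - xs))"
    unfolding inner_sum_left sum_distrib_left by (intro sum.cong refl inner)
  finally show ?thesis
    unfolding total sum_worker_gradients_minimizer gap_def by (simp add: algebra_simps)
qed

lemma gap_strongly_convex:
  "gap x + \<mu> / 2 * (norm (x - xs))\<^sup>2 \<le> gradient (objective n m f) x \<bullet> (x - xs)"
proof -
  let ?F = "worker_objective m f"
  have "(\<Sum>i=1..n. ?F i x - ?F i xs + \<mu> / 2 * (norm (x - xs))\<^sup>2) \<le> (\<Sum>i=1..n. gradient (?F i) x \<bullet> (x - xs))"
  proof (rule sum_mono)
    fix i assume "i \<in> {1..n}"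
    then have "?F i xs \<ge> ?F i x + gradient (?F i) x \<bullet> (xs - x) + \<mu> / 2 * (norm (x - xs))\<^sup>2"
      using worker_strongly_convex by (simp add: strongly_convex_def)
    then show "?F i x - ?F i xs + \<mu> / 2 * (norm (x - xs))\<^sup>2 \<le> gradient (?F i) x \<bullet> (x - xs)"
      by (simp add: inner_diff_right)
  qed
  also have "(\<Sum>i=1..n. ?F i x - ?F i xs + \<mu> / 2 * (norm (x - xs))\<^sup>2) = real n * (gap x + \<mu> / 2 * (norm (x - xs))\<^sup>2)"
    using n_pos by (simp add: gap_def objective_def sum.distrib sum_subtractf algebra_simps)
  also have "(\<Sum>i=1..n. gradient (?F i) x \<bullet> (x - xs)) = real n * (gradient (objective n m f) x \<bullet> (x - xs))"
    using n_pos by (simp add: gradient_objective inner_sum_left)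
  finally show ?thesis
    using n_pos by simp
qed

section \<open>Moments of one round from a fixed state\<close>

text \<open>The state is a fixed argument in this part; randomness comes from the draws of round \<open>k\<close>
  alone.\<close>
definition delta :: "nat \<Rightarrow> 'v vr_state \<Rightarrow> nat \<Rightarrow> 'a \<Rightarrow> 'v" where
  "delta k \<sigma> i z = vr_delta m f Q (\<lambda>i. J k i z) (\<lambda>i. S k i z) \<sigma> i"

definition worker_draws :: "nat \<Rightarrow> nat \<Rightarrow> draw set" where
  "worker_draws k i = {Index k i, Seed k i}"

text \<open>The variance of the sampled gradient of one worker: its mean over the uniform index is the full
  gradient of the worker (\<open>mean_estimator\<close>).\<close>
definition estimator_variance :: "'v vr_state \<Rightarrow> nat \<Rightarrow> real" where
  "estimator_variance \<sigma> i = (1 / real m) * (\<Sum>j=1..m.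
     (norm (vr_estimator m f \<sigma> i j - gradient (worker_objective m f i) (st_x \<sigma>)))\<^sup>2)"

lemma worker_draws_subset: "i \<in> {1..n} \<Longrightarrow> worker_draws k i \<subseteq> draws_of v n"
  by (auto simp: worker_draws_def draws_of_def)

lemma Q_measurable: "(\<lambda>(s, x). Q s x) \<in> borel_measurable (R \<Otimes>\<^sub>M borel)"
  using quantization by (simp add: quantization_operator_def)

lemma mean_estimator:
  assumes "i \<in> {1..n}"
  shows "(1 / real m) *\<^sub>R (\<Sum>j=1..m. vr_estimator m f \<sigma> i j) = gradient (worker_objective m f i) (st_x \<sigma>)"
  using m_pos assms
  by (simp add: vr_estimator_def gradient_worker_objective sum.distrib sum_subtractf
      sum_constant_scaleR scaleR_add_right scaleR_diff_right)

lemma mean_estimator_norm_sq: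
  assumes "i \<in> {1..n}"
  shows "(1 / real m) * (\<Sum>j=1..m. (norm (vr_estimator m f \<sigma> i j - h))\<^sup>2)
    = (norm (gradient (worker_objective m f i) (st_x \<sigma>) - h))\<^sup>2 + estimator_variance \<sigma> i"
  using sum_norm_sq_centered[OF m_pos, of "vr_estimator m f \<sigma> i" h] m_pos
  unfolding mean_estimator[OF assms] estimator_variance_def by (simp add: field_simps)

text \<open>The estimator is a centered version of the difference of the component gradients at the iterate
  and at the memory point. A variance is at most a second moment, and the second moment is split
  through the gradients at the minimizer.\<close>
lemma estimator_variance_le:
  assumes "i \<in> {1..n}"
  shows "real m * estimator_variance \<sigma> i
    \<le> 2 * (\<Sum>j=1..m. (norm (gradient (f i j) (st_x \<sigma>) - gradient (f i j) xs))\<^sup>2)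
      + 2 * (\<Sum>j=1..m. (norm (gradient (f i j) (st_w \<sigma> i j) - gradient (f i j) xs))\<^sup>2)"
proof -
  define a where "a j = gradient (f i j) (st_x \<sigma>) - gradient (f i j) xs" for j
  define e where "e j = gradient (f i j) (st_w \<sigma> i j) - gradient (f i j) xs" for j
  define s where "s j = a j - e j" for j
  have centered: "vr_estimator m f \<sigma> i j - gradient (worker_objective m f i) (st_x \<sigma>)
      = s j - (1 / real m) *\<^sub>R (\<Sum>j=1..m. s j)" for j
    using assms by (simp add: vr_estimator_def gradient_worker_objective s_def a_def e_def
        sum_subtractf scaleR_diff_right)
  have "real m * estimator_variance \<sigma> i = (\<Sum>j=1..m. (norm (s j - (1 / real m) *\<^sub>R (\<Sum>j=1..m. s j)))\<^sup>2)"
    using m_pos by (simp add: estimator_variance_def centered)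
  also have "\<dots> \<le> (\<Sum>j=1..m. (norm (s j))\<^sup>2)"
    by (rule sum_norm_sq_centered_le[OF m_pos])
  also have "\<dots> \<le> (\<Sum>j=1..m. 2 * (norm (a j))\<^sup>2 + 2 * (norm (e j))\<^sup>2)"
    unfolding s_def by (intro sum_mono norm_sq_diff_le)
  finally show ?thesis
    by (simp add: sum.distrib sum_distrib_left a_def e_def)
qed

lemma quantized_moments:
  assumes i: "i \<in> {1..n}"
  shows "(\<lambda>z. Q (S k i z) y) \<in> borel_measurable (draw_algebra {Seed k i})"
    "integrable M (\<lambda>z. Q (S k i z) y)" "expectation (\<lambda>z. Q (S k i z) y) = y"
    "integrable M (\<lambda>z. (norm (Q (S k i z) y))\<^sup>2)"
    "expectation (\<lambda>z. (norm (Q (S k i z) y))\<^sup>2) \<le> (\<omega> + 1) * (norm y)\<^sup>2"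
proof -
  have Qy: "(\<lambda>s. Q s y) \<in> borel_measurable R"
    using measurable_Pair1[OF Q_measurable, of y] by simp
  have S: "S k i \<in> measurable M R" and distr: "distr M R (S k i) = R"
    using draws i by (simp_all add: vr_diana_draws_def)
  have Q: "integrable R (\<lambda>s. Q s y)" "(\<integral>s. Q s y \<partial>R) = y" "integrable R (\<lambda>s. (norm (Q s y))\<^sup>2)"
    "(\<integral>s. (norm (Q s y))\<^sup>2 \<partial>R) \<le> (\<omega> + 1) * (norm y)\<^sup>2"
    using quantization by (simp_all add: quantization_operator_def)
  have Qy2: "(\<lambda>s. (norm (Q s y))\<^sup>2) \<in> borel_measurable R"
    using Qy by measurable
  show "(\<lambda>z. Q (S k i z) y) \<in> borel_measurable (draw_algebra {Seed k i})"
    using i by (intro measurable_compose[OF measurable_seed Qy]) auto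
  show "integrable M (\<lambda>z. Q (S k i z) y)" "expectation (\<lambda>z. Q (S k i z) y) = y"
    using Q(1,2) integrable_distr_eq[OF S Qy] integral_distr[OF S Qy] by (simp_all add: distr)
  show "integrable M (\<lambda>z. (norm (Q (S k i z) y))\<^sup>2)"
    "expectation (\<lambda>z. (norm (Q (S k i z) y))\<^sup>2) \<le> (\<omega> + 1) * (norm y)\<^sup>2"
    using Q(3,4) integrable_distr_eq[OF S Qy2] integral_distr[OF S Qy2] by (simp_all add: distr)
qed

lemma state_measurable_const: "state_measurable n m A (\<lambda>z. \<sigma>)"
  by (simp add: state_measurable_def)

lemma measurable_delta:
  assumes "i \<in> {1..n}"
  shows "delta k \<sigma> i \<in> borel_measurable (draw_algebra (worker_draws k i))"
  unfolding delta_def[abs_def]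
  by (rule measurable_vr_delta[where J = "\<lambda>z i. J k i z" and S = "\<lambda>z i. S k i z",
        OF measurable_gradient Q_measurable state_measurable_const assms])
    (assumption | rule measurable_index measurable_seed; use assms in \<open>simp add: worker_draws_def\<close>)+

text \<open>Average first over the quantization with the index fixed, then over the index. The bias-variance
  decomposition of the quantized vectors yields the second moment bound.\<close>
lemma delta_moments:
  fixes \<sigma> :: "'v vr_state" and i k :: nat
  assumes i: "i \<in> {1..n}"
  defines "d \<equiv> gradient (worker_objective m f i) (st_x \<sigma>) - st_h \<sigma> i"
  shows "integrable M (delta k \<sigma> i)" "expectation (delta k \<sigma> i) = d"
    "integrable M (\<lambda>z. (norm (delta k \<sigma> i z))\<^sup>2)"
    "expectation (\<lambda>z. (norm (delta k \<sigma> i z))\<^sup>2) \<le> (\<omega> + 1) * ((norm d)\<^sup>2 + estimator_variance \<sigma> i)"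
proof -
  define y where "y j = vr_estimator m f \<sigma> i j - st_h \<sigma> i" for j
  have delta_eq: "delta k \<sigma> i z = Q (S k i z) (y (J k i z))" for z
    by (simp add: delta_def vr_delta_def y_def)
  have sub: "{Index k i} \<subseteq> draws_of v n" "{Seed k i} \<subseteq> draws_of v n"
    using i by (auto simp: draws_of_def)
  have alg: "subalgebra M (draw_algebra {Index k i})" "subalgebra M (draw_algebra {Seed k i})"
    "indep_set (sets (draw_algebra {Index k i})) (sets (draw_algebra {Seed k i}))"
    using sub by (auto intro: subalgebra_draw_algebra indep_draw_algebras)
  have Jm: "J k i \<in> measurable (draw_algebra {Index k i}) (count_space {1..m})"
    using i by (intro measurable_index) auto
  have Jd: "distr M (count_space {1..m}) (J k i) = uniform_count_measure {1..m}"
    using draws i by (simp add: vr_diana_draws_def)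
  note moments = quantized_moments[OF i]
  note uniform = expectation_uniform_index[OF alg Jm Jd]
  have sq_meas: "(\<lambda>z. (norm (Q (S k i z) x))\<^sup>2) \<in> borel_measurable (draw_algebra {Seed k i})" for x
    using moments(1) by measurable
  note mean = uniform[of "\<lambda>j z. Q (S k i z) (y j)", OF moments(1,2)]
  note square = uniform[of "\<lambda>j z. (norm (Q (S k i z) (y j)))\<^sup>2", OF sq_meas moments(4)]
  show "integrable M (delta k \<sigma> i)"
    using mean(1) by (simp add: delta_eq[abs_def])
  have "expectation (delta k \<sigma> i) = (1 / real m) *\<^sub>R (\<Sum>j=1..m. y j)"
    using mean(2) by (simp add: delta_eq[abs_def] moments(3))
  also have "\<dots> = d"
    using mean_estimator[OF i, of \<sigma>] m_pos
    by (simp add: y_def d_def sum_subtractf sum_constant_scaleR scaleR_diff_right)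
  finally show "expectation (delta k \<sigma> i) = d" .
  show "integrable M (\<lambda>z. (norm (delta k \<sigma> i z))\<^sup>2)"
    using square(1) by (simp add: delta_eq)
  have "expectation (\<lambda>z. (norm (delta k \<sigma> i z))\<^sup>2)
      = (1 / real m) * (\<Sum>j=1..m. expectation (\<lambda>z. (norm (Q (S k i z) (y j)))\<^sup>2))"
    using square(2) by (simp add: delta_eq)
  also have "\<dots> \<le> (1 / real m) * (\<Sum>j=1..m. (\<omega> + 1) * (norm (y j))\<^sup>2)"
    by (intro mult_left_mono sum_mono moments(5)) auto
  also have "\<dots> = (\<omega> + 1) * ((1 / real m) * (\<Sum>j=1..m. (norm (y j))\<^sup>2))"
    by (simp add: sum_distrib_left mult_ac)
  also have "\<dots> = (\<omega> + 1) * ((norm d)\<^sup>2 + estimator_variance \<sigma> i)"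
    unfolding y_def d_def mean_estimator_norm_sq[OF i] by (rule refl)
  finally show "expectation (\<lambda>z. (norm (delta k \<sigma> i z))\<^sup>2) \<le> (\<omega> + 1) * ((norm d)\<^sup>2 + estimator_variance \<sigma> i)" .
qed

text \<open>The condition \<open>\<alpha> * (\<omega> + 1) \<le> 1\<close> reduces the quadratic term in \<open>\<alpha>\<close> to a linear one. The mean step
  then moves the shift towards the gradient at the iterate, and the polarization identity replaces
  the cross term by the distances of both from the gradient at the minimizer.\<close>
lemma expected_shift_error:
  assumes i: "i \<in> {1..n}"
  defines "G \<equiv> gradient (worker_objective m f i)"
  shows "integrable M (\<lambda>z. (norm (st_h \<sigma> i + \<alpha> *\<^sub>R delta k \<sigma> i z - G xs))\<^sup>2)"
    "expectation (\<lambda>z. (norm (st_h \<sigma> i + \<alpha> *\<^sub>R delta k \<sigma> i z - G xs))\<^sup>2)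
      \<le> (1 - \<alpha>) * (norm (st_h \<sigma> i - G xs))\<^sup>2
        + \<alpha> * ((norm (G (st_x \<sigma>) - G xs))\<^sup>2 + estimator_variance \<sigma> i)"
proof -
  define a where "a = st_h \<sigma> i - G xs"
  define d where "d = G (st_x \<sigma>) - st_h \<sigma> i"
  note delta = delta_moments[OF i, of k \<sigma>, folded G_def, folded d_def]
  have eq: "st_h \<sigma> i + \<alpha> *\<^sub>R delta k \<sigma> i z - G xs = a + \<alpha> *\<^sub>R delta k \<sigma> i z" for z
    by (simp add: a_def)
  note affine = expectation_norm_sq_affine[OF delta(1,3), of a \<alpha>]
  show "integrable M (\<lambda>z. (norm (st_h \<sigma> i + \<alpha> *\<^sub>R delta k \<sigma> i z - G xs))\<^sup>2)"
    unfolding eq by (rule affine)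
  have "\<alpha> * (\<omega> + 1) \<le> 1"
    using \<alpha>_le \<omega>_nonneg by (simp add: field_simps)
  have var: "0 \<le> (norm d)\<^sup>2 + estimator_variance \<sigma> i"
    by (simp add: estimator_variance_def sum_nonneg)
  have "\<alpha>\<^sup>2 * expectation (\<lambda>z. (norm (delta k \<sigma> i z))\<^sup>2)
      \<le> \<alpha>\<^sup>2 * ((\<omega> + 1) * ((norm d)\<^sup>2 + estimator_variance \<sigma> i))"
    using delta(4) by (intro mult_left_mono) auto
  also have "\<dots> = (\<alpha> * (\<omega> + 1)) * (\<alpha> * ((norm d)\<^sup>2 + estimator_variance \<sigma> i))"
    by (simp add: power2_eq_square)
  also have "\<dots> \<le> 1 * (\<alpha> * ((norm d)\<^sup>2 + estimator_variance \<sigma> i))"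
    using \<open>\<alpha> * (\<omega> + 1) \<le> 1\<close> var \<alpha>_pos by (intro mult_right_mono) auto
  finally have "expectation (\<lambda>z. (norm (a + \<alpha> *\<^sub>R delta k \<sigma> i z))\<^sup>2)
      \<le> (norm a)\<^sup>2 + 2 * \<alpha> * (a \<bullet> d) + \<alpha> * ((norm d)\<^sup>2 + estimator_variance \<sigma> i)"
    unfolding affine(2) delta(2) by simp
  also have "(norm a)\<^sup>2 + 2 * \<alpha> * (a \<bullet> d) + \<alpha> * ((norm d)\<^sup>2 + estimator_variance \<sigma> i)
      = (norm a)\<^sup>2 + \<alpha> * (2 * (a \<bullet> d) + (norm d)\<^sup>2) + \<alpha> * estimator_variance \<sigma> i"
    by (simp add: distrib_left)
  also have "2 * (a \<bullet> d) + (norm d)\<^sup>2 = (norm (G (st_x \<sigma>) - G xs))\<^sup>2 - (norm a)\<^sup>2"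
  proof -
    have "G (st_x \<sigma>) - G xs = a + d"
      by (simp add: a_def d_def)
    then show ?thesis
      by (simp add: power2_norm_eq_inner inner_add inner_commute[of d a])
  qed
  also have "(norm a)\<^sup>2 + \<alpha> * ((norm (G (st_x \<sigma>) - G xs))\<^sup>2 - (norm a)\<^sup>2) + \<alpha> * estimator_variance \<sigma> i
      = (1 - \<alpha>) * (norm a)\<^sup>2 + \<alpha> * ((norm (G (st_x \<sigma>) - G xs))\<^sup>2 + estimator_variance \<sigma> i)"
    by (simp add: algebra_simps)
  finally show "expectation (\<lambda>z. (norm (st_h \<sigma> i + \<alpha> *\<^sub>R delta k \<sigma> i z - G xs))\<^sup>2)
      \<le> (1 - \<alpha>) * (norm (st_h \<sigma> i - G xs))\<^sup>2
        + \<alpha> * ((norm (G (st_x \<sigma>) - G xs))\<^sup>2 + estimator_variance \<sigma> i)"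
    unfolding eq a_def[symmetric] .
qed

text \<open>The descent direction is unbiased, which gives the linear term. Its second moment is the squared
  gradient plus the variances of the independent workers; subtracting the squared mean from the bound
  of \<open>delta_moments\<close> leaves the factor \<open>\<omega>\<close> in front of the shift error.\<close>
lemma expected_iterate_error:
  fixes k :: nat and \<sigma> :: "'v vr_state"
  defines "x \<equiv> st_x \<sigma>" and "G \<equiv> \<lambda>i. gradient (worker_objective m f i)"
    and "g \<equiv> \<lambda>z. (1 / real n) *\<^sub>R (\<Sum>i=1..n. delta k \<sigma> i z + st_h \<sigma> i)"
  shows "integrable M (\<lambda>z. (norm (x - \<gamma> *\<^sub>R g z - xs))\<^sup>2)"
    "expectation (\<lambda>z. (norm (x - \<gamma> *\<^sub>R g z - xs))\<^sup>2)
      \<le> (norm (x - xs))\<^sup>2 - 2 * \<gamma> * (gradient (objective n m f) x \<bullet> (x - xs))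
        + \<gamma>\<^sup>2 * ((norm (gradient (objective n m f) x))\<^sup>2
          + (1 / (real n)\<^sup>2) * (\<Sum>i=1..n. \<omega> * (norm (G i x - st_h \<sigma> i))\<^sup>2 + (\<omega> + 1) * estimator_variance \<sigma> i))"
proof -
  \<comment> \<open>The trivial factor \<open>1\<close> puts \<open>Y\<close> into the form of \<open>expectation_norm_sq_affine\<close>.\<close>
  define Y where "Y i z = st_h \<sigma> i + 1 *\<^sub>R delta k \<sigma> i z" for i z
  have int: "integrable M (Y i)" and mean: "expectation (Y i) = G i x"
    and sq_int: "integrable M (\<lambda>z. (norm (Y i z))\<^sup>2)"
    and var: "expectation (\<lambda>z. (norm (Y i z))\<^sup>2) - (norm (G i x))\<^sup>2
      \<le> \<omega> * (norm (G i x - st_h \<sigma> i))\<^sup>2 + (\<omega> + 1) * estimator_variance \<sigma> i"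
    if i: "i \<in> {1..n}" for i
  proof -
    note delta = delta_moments[OF i, of k \<sigma>]
    note affine = expectation_norm_sq_affine[OF delta(1,3), of "st_h \<sigma> i" 1, folded Y_def]
    show "integrable M (Y i)" "expectation (Y i) = G i x"
      unfolding Y_def[abs_def] using delta(1,2) by (simp_all add: prob_space G_def x_def)
    show "integrable M (\<lambda>z. (norm (Y i z))\<^sup>2)"
      by (rule affine)
    have "(norm (G i x))\<^sup>2 = (norm (st_h \<sigma> i))\<^sup>2 + 2 * (st_h \<sigma> i \<bullet> (G i x - st_h \<sigma> i)) + (norm (G i x - st_h \<sigma> i))\<^sup>2"
      by (simp add: power2_norm_eq_inner inner_diff inner_commute[of "G i x" "st_h \<sigma> i"])
    then show "expectation (\<lambda>z. (norm (Y i z))\<^sup>2) - (norm (G i x))\<^sup>2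
        \<le> \<omega> * (norm (G i x - st_h \<sigma> i))\<^sup>2 + (\<omega> + 1) * estimator_variance \<sigma> i"
      using delta(4) unfolding affine(2) delta(2) by (simp add: G_def x_def algebra_simps)
  qed
  have cross: "integrable M (\<lambda>z. Y i z \<bullet> Y l z)" "expectation (\<lambda>z. Y i z \<bullet> Y l z) = G i x \<bullet> G l x"
    if il: "i \<in> {1..n}" "l \<in> {1..n}" "i \<noteq> l" for i l
  proof -
    have meas: "Y i \<in> borel_measurable (draw_algebra (worker_draws k i))" if "i \<in> {1..n}" for i
      unfolding Y_def[abs_def] using measurable_delta[OF that] by simp
    have "worker_draws k i \<inter> worker_draws k l = {}"
      using il by (auto simp: worker_draws_def)
    then have "indep_set (sets (draw_algebra (worker_draws k i))) (sets (draw_algebra (worker_draws k l)))"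
      using il by (intro indep_draw_algebras worker_draws_subset)
    from expectation_inner_indep[OF subalgebra_draw_algebra[OF worker_draws_subset[OF il(1)]]
        subalgebra_draw_algebra[OF worker_draws_subset[OF il(2)]]
        this meas[OF il(1)] meas[OF il(2)] int[OF il(1)] int[OF il(2)]]
    show "integrable M (\<lambda>z. Y i z \<bullet> Y l z)" "expectation (\<lambda>z. Y i z \<bullet> Y l z) = G i x \<bullet> G l x"
      unfolding mean[OF il(1)] mean[OF il(2)] .
  qed
  define Z where "Z z = (\<Sum>i=1..n. Y i z)" for z
  have Z_int: "integrable M Z"
    unfolding Z_def[abs_def] by (intro Bochner_Integration.integrable_sum int)
  have Z_mean: "expectation Z = real n *\<^sub>R gradient (objective n m f) x"
    unfolding Z_def[abs_def] using n_pos
    by (simp add: Bochner_Integration.integral_sum int mean gradient_objective G_def)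
  have Z_sq_int: "integrable M (\<lambda>z. (norm (Z z))\<^sup>2)"
    and Z_sq: "expectation (\<lambda>z. (norm (Z z))\<^sup>2)
      = (norm (\<Sum>i=1..n. G i x))\<^sup>2 + (\<Sum>i=1..n. expectation (\<lambda>z. (norm (Y i z))\<^sup>2) - (norm (G i x))\<^sup>2)"
    unfolding Z_def using expectation_norm_sq_sum_uncorrelated[of "{1..n}" Y "\<lambda>i. G i x"] sq_int cross
    by simp_all
  let ?r = "- (\<gamma> / real n)"
  let ?V = "\<Sum>i=1..n. \<omega> * (norm (G i x - st_h \<sigma> i))\<^sup>2 + (\<omega> + 1) * estimator_variance \<sigma> i"
  have eq: "x - \<gamma> *\<^sub>R g z - xs = (x - xs) + ?r *\<^sub>R Z z" for z
    by (simp add: g_def Z_def Y_def add.commute)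
  note affine = expectation_norm_sq_affine[OF Z_int Z_sq_int, of "x - xs" ?r]
  show "integrable M (\<lambda>z. (norm (x - \<gamma> *\<^sub>R g z - xs))\<^sup>2)"
    unfolding eq by (rule affine)
  have "expectation (\<lambda>z. (norm (x - \<gamma> *\<^sub>R g z - xs))\<^sup>2)
      = (norm (x - xs))\<^sup>2 - 2 * \<gamma> * (gradient (objective n m f) x \<bullet> (x - xs))
        + ?r\<^sup>2 * expectation (\<lambda>z. (norm (Z z))\<^sup>2)"
    unfolding eq affine(2) Z_mean using n_pos by (simp add: inner_commute)
  also have "?r\<^sup>2 * expectation (\<lambda>z. (norm (Z z))\<^sup>2) \<le> ?r\<^sup>2 * ((norm (\<Sum>i=1..n. G i x))\<^sup>2 + ?V)"
    unfolding Z_sq by (intro mult_left_mono add_left_mono sum_mono var) auto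
  also have "\<dots> = \<gamma>\<^sup>2 * ((norm (gradient (objective n m f) x))\<^sup>2 + (1 / (real n)\<^sup>2) * ?V)"
    using n_pos by (simp add: gradient_objective G_def power_divide power_mult_distrib field_simps)
  finally show "expectation (\<lambda>z. (norm (x - \<gamma> *\<^sub>R g z - xs))\<^sup>2)
      \<le> (norm (x - xs))\<^sup>2 - 2 * \<gamma> * (gradient (objective n m f) x \<bullet> (x - xs))
        + \<gamma>\<^sup>2 * ((norm (gradient (objective n m f) x))\<^sup>2 + (1 / (real n)\<^sup>2) * ?V)"
    by simp
qed

section \<open>Contraction in one round\<close>

text \<open>Up to the factor \<open>L * n\<close>, the step size is the reciprocal of the total weight that \<open>contraction_arithmetic\<close> puts on the
  gradient deviations.\<close>
lemma gradient_step_coefficient: "\<gamma> * (1 / real n + 36 * ((\<omega> + 1) / (real n)\<^sup>2)) = 1 / (L * real n)"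
proof -
  have "1 + 36 * (\<omega> + 1) / real n > 0"
    using \<omega>_nonneg by (intro add_pos_nonneg) auto
  moreover have "1 / real n + 36 * ((\<omega> + 1) / (real n)\<^sup>2) = (1 + 36 * (\<omega> + 1) / real n) / real n"
    using n_pos by (simp add: field_simps power2_eq_square)
  ultimately show ?thesis
    using L_pos n_pos by (simp add: \<gamma>_def)
qed

lemma \<gamma>_pos: "\<gamma> > 0"
  using L_pos \<omega>_nonneg by (simp add: \<gamma>_def add_pos_nonneg)

lemma b_nonneg: "b \<ge> 0" and c_nonneg: "c \<ge> 0"
  using \<omega>_nonneg \<alpha>_pos by (simp_all add: b_def c_def)

text \<open>Here \<open>r\<close> is the squared distance of the iterate from the minimizer, \<open>q\<close> the gradient deviation
  divided by \<open>m\<close>, \<open>B\<close> the optimality gap, \<open>P\<close> the inner product of the gradient with the error, \<open>G\<close>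
  the squared norm of the gradient, \<open>d\<close> the summed squared distances of the shifts from the gradients
  of the workers, \<open>V\<close> the summed sampling variance, and \<open>X\<close>, \<open>H'\<close>, \<open>D'\<close> the expectations after one round.

  In terms of \<open>u = (\<omega> + 1) / n\<^sup>2\<close> one has \<open>b * \<alpha> = 4 * u\<close> and \<open>c = 16 * u\<close>, and up to the common factor
  \<open>\<gamma>\<^sup>2\<close> the balance is as follows. The noise of the direction adds \<open>2 * u * H\<close>, which uses up half of the
  decrease \<open>4 * u * H\<close> of the shift term. It also adds \<open>2 * u * D / m\<close>, and the shift term adds
  \<open>8 * u * D / m\<close>, out of the decrease \<open>16 * u * D / m\<close> of the memory term; the fraction \<open>6 / 16\<close> remains.
  The deviation \<open>q\<close> is collected with weight \<open>1 / n\<close> from the squared gradient and \<open>4 * u\<close>, \<open>12 * u\<close>,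
  \<open>16 * u\<close> from noise, shift and memory, in total at most \<open>1 / n + 36 * u\<close>.\<close>
lemma contraction_arithmetic:
  fixes r q B P H D X V G d H' D' :: real
  assumes nonneg: "0 \<le> r" "0 \<le> q" "0 \<le> H" "0 \<le> D"
    and q: "q \<le> 2 * L * real n * B"
    and P: "B + \<mu> / 2 * r \<le> P"
    and X: "X \<le> r - 2 * \<gamma> * P + \<gamma>\<^sup>2 * (G + (1 / (real n)\<^sup>2) * (\<omega> * d + (\<omega> + 1) * V))"
    and G: "G \<le> q / real n"
    and d: "d \<le> 2 * q + 2 * H"
    and V: "V \<le> 2 * q + 2 * D / real m"
    and H': "H' \<le> (1 - \<alpha>) * H + \<alpha> * (q + V)"
    and D': "D' \<le> (1 - 1 / real m) * D + q"
  shows "X + b * \<gamma>\<^sup>2 * H' + c * \<gamma>\<^sup>2 * D' \<le> (1 - \<rho>) * (r + b * \<gamma>\<^sup>2 * H + c * \<gamma>\<^sup>2 * D)"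
proof -
  define u where "u = (\<omega> + 1) / (real n)\<^sup>2"
  have u: "0 \<le> u" "b * \<alpha> = 4 * u" "c = 16 * u"
    using \<omega>_nonneg \<alpha>_pos by (simp_all add: u_def b_def c_def)
  define e where "e = D / real m"
  have e: "0 \<le> e"
    using nonneg by (simp add: e_def)
  have V': "V \<le> 2 * q + 2 * e"
    using V by (simp add: e_def)
  have noise: "(1 / (real n)\<^sup>2) * (\<omega> * d + (\<omega> + 1) * V) \<le> u * (2 * q + 2 * H) + u * (2 * q + 2 * e)"
  proof -
    have "\<omega> * d \<le> \<omega> * (2 * q + 2 * H)"
      using d \<omega>_nonneg by (intro mult_left_mono)
    also have "\<dots> \<le> (\<omega> + 1) * (2 * q + 2 * H)"
      using nonneg by (intro mult_right_mono) auto
    finally have "\<omega> * d + (\<omega> + 1) * V \<le> (\<omega> + 1) * (2 * q + 2 * H) + (\<omega> + 1) * (2 * q + 2 * e)"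
      using V' \<omega>_nonneg by (intro add_mono mult_left_mono) auto
    then have "(1 / (real n)\<^sup>2) * (\<omega> * d + (\<omega> + 1) * V)
        \<le> (1 / (real n)\<^sup>2) * ((\<omega> + 1) * (2 * q + 2 * H) + (\<omega> + 1) * (2 * q + 2 * e))"
      by (intro mult_left_mono) auto
    also have "\<dots> = u * (2 * q + 2 * H) + u * (2 * q + 2 * e)"
      unfolding u_def distrib_left by simp
    finally show ?thesis .
  qed
  have "\<gamma>\<^sup>2 * (G + (1 / (real n)\<^sup>2) * (\<omega> * d + (\<omega> + 1) * V))
      \<le> \<gamma>\<^sup>2 * (q / real n + (u * (2 * q + 2 * H) + u * (2 * q + 2 * e)))"
    using G noise by (intro mult_left_mono add_mono) auto
  moreover have "b * \<gamma>\<^sup>2 * H' \<le> b * \<gamma>\<^sup>2 * ((1 - \<alpha>) * H + \<alpha> * (3 * q + 2 * e))"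
  proof -
    have "\<alpha> * (q + V) \<le> \<alpha> * (3 * q + 2 * e)"
      using V' \<alpha>_pos by (intro mult_left_mono) auto
    then have "H' \<le> (1 - \<alpha>) * H + \<alpha> * (3 * q + 2 * e)"
      using H' by linarith
    then show ?thesis
      using b_nonneg by (intro mult_left_mono) auto
  qed
  moreover have "c * \<gamma>\<^sup>2 * D' \<le> c * \<gamma>\<^sup>2 * (D - e + q)"
    using D' c_nonneg by (intro mult_left_mono) (auto simp: e_def algebra_simps)
  ultimately have "X + b * \<gamma>\<^sup>2 * H' + c * \<gamma>\<^sup>2 * D'
      \<le> r - 2 * \<gamma> * P + \<gamma>\<^sup>2 * (q / real n + (u * (2 * q + 2 * H) + u * (2 * q + 2 * e)))
        + b * \<gamma>\<^sup>2 * ((1 - \<alpha>) * H + \<alpha> * (3 * q + 2 * e)) + c * \<gamma>\<^sup>2 * (D - e + q)"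
    using X by linarith
  also have "\<dots> = r - 2 * \<gamma> * P + \<gamma>\<^sup>2 * (q / real n + 32 * u * q)
      + (1 - \<alpha> / 2) * (b * \<gamma>\<^sup>2 * H) + (c * \<gamma>\<^sup>2 * D - 6 * u * \<gamma>\<^sup>2 * e)"
  proof -
    have "b * \<gamma>\<^sup>2 * ((1 - \<alpha>) * H + \<alpha> * (3 * q + 2 * e))
        = b * \<gamma>\<^sup>2 * H + (b * \<alpha>) * \<gamma>\<^sup>2 * (3 * q + 2 * e - H)"
      by (simp add: algebra_simps)
    then have shift: "b * \<gamma>\<^sup>2 * ((1 - \<alpha>) * H + \<alpha> * (3 * q + 2 * e))
        = b * \<gamma>\<^sup>2 * H + 4 * u * \<gamma>\<^sup>2 * (3 * q + 2 * e - H)"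
      unfolding u .
    have "(1 - \<alpha> / 2) * (b * \<gamma>\<^sup>2 * H) = b * \<gamma>\<^sup>2 * H - (b * \<alpha>) * \<gamma>\<^sup>2 * H / 2"
      by (simp add: algebra_simps)
    then have contract: "(1 - \<alpha> / 2) * (b * \<gamma>\<^sup>2 * H) = b * \<gamma>\<^sup>2 * H - 2 * u * \<gamma>\<^sup>2 * H"
      unfolding u by simp
    show ?thesis
      unfolding shift contract u(3) by (simp add: algebra_simps)
  qed
  also have "c * \<gamma>\<^sup>2 * D - 6 * u * \<gamma>\<^sup>2 * e = (1 - 3 / (8 * real m)) * (c * \<gamma>\<^sup>2 * D)"
    unfolding u(3) e_def by (simp add: algebra_simps)
  also have "\<gamma>\<^sup>2 * (q / real n + 32 * u * q) \<le> 2 * \<gamma> * B"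
  proof -
    have "\<gamma>\<^sup>2 * (q / real n + 32 * u * q) \<le> \<gamma>\<^sup>2 * (q / real n + 36 * u * q)"
      using u nonneg by (intro mult_left_mono) (auto intro!: mult_right_mono)
    also have "\<dots> = \<gamma> * ((\<gamma> * (1 / real n + 36 * u)) * q)"
      by (simp add: power2_eq_square algebra_simps)
    also have "\<dots> = \<gamma> * (q / (L * real n))"
      unfolding u_def gradient_step_coefficient by simp
    also have "\<dots> \<le> \<gamma> * (2 * B)"
      using q L_pos n_pos \<gamma>_pos by (intro mult_left_mono) (auto simp: divide_le_eq mult_ac)
    finally show ?thesis
      by simp
  qed
  also have "2 * \<gamma> * B \<le> 2 * \<gamma> * P - \<gamma> * \<mu> * r"
  proof -
    have "2 * \<gamma> * (B + \<mu> / 2 * r) \<le> 2 * \<gamma> * P"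
      using P \<gamma>_pos by (intro mult_left_mono) auto
    then show ?thesis
      by (simp add: algebra_simps)
  qed
  finally have "X + b * \<gamma>\<^sup>2 * H' + c * \<gamma>\<^sup>2 * D'
      \<le> (1 - \<gamma> * \<mu>) * r + (1 - \<alpha> / 2) * (b * \<gamma>\<^sup>2 * H) + (1 - 3 / (8 * real m)) * (c * \<gamma>\<^sup>2 * D)"
    by (simp add: algebra_simps)
  also have "\<dots> \<le> (1 - \<rho>) * r + (1 - \<rho>) * (b * \<gamma>\<^sup>2 * H) + (1 - \<rho>) * (c * \<gamma>\<^sup>2 * D)"
    using \<rho>_le nonneg b_nonneg c_nonneg by (intro add_mono mult_right_mono) auto
  finally show ?thesis
    by (simp add: algebra_simps)
qed

text \<open>Both variants refresh a given memory point with probability \<open>1 / m\<close>. L-SVRG does so with one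
  coin for all workers and SAGA with one index per worker, but the expected memory error is a sum
  over memory points and sees only these marginal probabilities.\<close>
lemma prob_refresh:
  assumes i: "i \<in> {1..n}" and j: "j \<in> {1..m}"
  shows "{z \<in> space M. case v of L_SVRG \<Rightarrow> U k z | SAGA \<Rightarrow> j = J k i z} \<in> events"
    "prob {z \<in> space M. case v of L_SVRG \<Rightarrow> U k z | SAGA \<Rightarrow> j = J k i z} = 1 / real m"
proof -
  let ?A = "{z \<in> space M. case v of L_SVRG \<Rightarrow> U k z | SAGA \<Rightarrow> j = J k i z}"
  have "?A \<in> events \<and> prob ?A = 1 / real m"
  proof (cases v)
    case L_SVRG
    then have U: "U k \<in> measurable M (count_space UNIV)"
      and distr: "distr M (count_space UNIV) (U k) = measure_pmf (bernoulli_pmf (1 / real m))"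
      using draws by (simp_all add: vr_diana_draws_def)
    have A: "?A = U k -` {True} \<inter> space M"
      using L_SVRG by auto
    have "prob ?A = measure (distr M (count_space UNIV) (U k)) {True}"
      unfolding A using U by (subst measure_distr) auto
    also have "\<dots> = 1 / real m"
      using m_pos unfolding distr measure_pmf_single by (subst pmf_bernoulli_True) auto
    finally show ?thesis
      unfolding A using U by (auto intro: measurable_sets)
  next
    case SAGA
    have J: "J k i \<in> measurable M (count_space {1..m})"
      and distr: "distr M (count_space {1..m}) (J k i) = uniform_count_measure {1..m}"
      using draws i by (simp_all add: vr_diana_draws_def)
    have A: "?A = {z \<in> space M. J k i z = j}" "?A = J k i -` {j} \<inter> space M"
      using SAGA by auto
    have "?A \<in> events"
      unfolding A(2) using j by (intro measurable_sets[OF J]) simp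
    then show ?thesis
      using prob_uniform_index[OF J distr j] A(1) by simp
  qed
  then show "?A \<in> events" "prob ?A = 1 / real m"
    by auto
qed

definition step :: "nat \<Rightarrow> 'v vr_state \<Rightarrow> 'a \<Rightarrow> 'v vr_state" where
  "step k \<sigma> z = vr_diana_step v n m f Q \<alpha> \<gamma> (U k z) (\<lambda>i. J k i z) (\<lambda>i. S k i z) \<sigma>"

abbreviation potential :: "'v vr_state \<Rightarrow> real" where
  "potential \<equiv> lyapunov n m f xs b c \<gamma>"

lemma potential_nonneg: "0 \<le> potential \<sigma>"
  unfolding lyapunov_def H_term_def D_term_def using b_nonneg c_nonneg
  by (intro add_nonneg_nonneg mult_nonneg_nonneg sum_nonneg) auto

lemma expected_memory_error:
  "integrable M (\<lambda>z. D_term n m f xs (step k \<sigma> z))"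
  "expectation (\<lambda>z. D_term n m f xs (step k \<sigma> z))
    = (1 - 1 / real m) * D_term n m f xs \<sigma> + deviation (st_x \<sigma>) / real m"
proof -
  define s where "s i j = (norm (gradient (f i j) (st_x \<sigma>) - gradient (f i j) xs))\<^sup>2" for i j
  define t where "t i j = (norm (gradient (f i j) (st_w \<sigma> i j) - gradient (f i j) xs))\<^sup>2" for i j
  let ?P = "\<lambda>i j z. case v of L_SVRG \<Rightarrow> U k z | SAGA \<Rightarrow> j = J k i z"
  have eq: "D_term n m f xs (step k \<sigma> z) = (\<Sum>i=1..n. \<Sum>j=1..m. if ?P i j z then s i j else t i j)" for z
    unfolding D_term_def step_def vr_diana_step_def vr_state.simps s_def t_def
    by (intro sum.cong refl) simp
  note event = expectation_if_event[OF prob_refresh]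
  show "integrable M (\<lambda>z. D_term n m f xs (step k \<sigma> z))"
    unfolding eq by (intro Bochner_Integration.integrable_sum event)
  have "expectation (\<lambda>z. D_term n m f xs (step k \<sigma> z))
      = (\<Sum>i=1..n. \<Sum>j=1..m. expectation (\<lambda>z. if ?P i j z then s i j else t i j))"
    unfolding eq
    by (subst Bochner_Integration.integral_sum, intro Bochner_Integration.integrable_sum event, assumption+)
      (intro sum.cong refl Bochner_Integration.integral_sum event)
  also have "\<dots> = (\<Sum>i=1..n. \<Sum>j=1..m. 1 / real m * s i j + (1 - 1 / real m) * t i j)"
    by (intro sum.cong refl event)
  also have "\<dots> = 1 / real m * deviation (st_x \<sigma>) + (1 - 1 / real m) * D_term n m f xs \<sigma>"
    unfolding deviation_def D_term_def s_def t_def by (simp only: sum.distrib sum_distrib_left)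
  finally show "expectation (\<lambda>z. D_term n m f xs (step k \<sigma> z))
      = (1 - 1 / real m) * D_term n m f xs \<sigma> + deviation (st_x \<sigma>) / real m"
    by simp
qed

text \<open>Assembles the three expected errors. Besides the moment bounds it needs every gradient term in
  units of \<open>q\<close>: averaging over components (\<open>g\<close>) or over all workers (\<open>full\<close>) cannot increase the mean
  square, by convexity of the squared norm.\<close>
lemma one_step_contraction:
  "integrable M (\<lambda>z. potential (step k \<sigma> z))"
  "expectation (\<lambda>z. potential (step k \<sigma> z)) \<le> (1 - \<rho>) * potential \<sigma>"
proof -
  define x where "x = st_x \<sigma>"
  define G where "G i = gradient (worker_objective m f i)" for i
  define q where "q = deviation x / real m"
  define H where "H = H_term n m f xs \<sigma>"
  define D where "D = D_term n m f xs \<sigma>"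
  define shift where "shift i z = (norm (st_h \<sigma> i + \<alpha> *\<^sub>R delta k \<sigma> i z - G i xs))\<^sup>2" for i z
  define iterate where "iterate z =
    (norm (x - \<gamma> *\<^sub>R ((1 / real n) *\<^sub>R (\<Sum>i=1..n. delta k \<sigma> i z + st_h \<sigma> i)) - xs))\<^sup>2" for z
  define memory where "memory z = D_term n m f xs (step k \<sigma> z)" for z
  have potential_step: "potential (step k \<sigma> z)
      = iterate z + b * \<gamma>\<^sup>2 * (\<Sum>i=1..n. shift i z) + c * \<gamma>\<^sup>2 * memory z" for z
    unfolding lyapunov_def iterate_def shift_def memory_def H_term_def
    by (simp add: step_def vr_diana_step_def delta_def x_def G_def)
  note iterate = expected_iterate_error[of \<sigma> k, folded x_def, folded iterate_def, folded G_def]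
  note shift = expected_shift_error[of _ \<sigma> k, folded G_def, folded shift_def, folded x_def]
  note memory = expected_memory_error[of k \<sigma>, folded memory_def, folded x_def, folded D_def]
  have shift_int: "integrable M (\<lambda>z. \<Sum>i=1..n. shift i z)"
    by (intro Bochner_Integration.integrable_sum shift)
  show "integrable M (\<lambda>z. potential (step k \<sigma> z))"
    unfolding potential_step using iterate(1) shift_int memory(1) by simp
  have expect: "expectation (\<lambda>z. potential (step k \<sigma> z))
      = expectation iterate + b * \<gamma>\<^sup>2 * (\<Sum>i=1..n. expectation (shift i)) + c * \<gamma>\<^sup>2 * expectation memory"
    unfolding potential_step using iterate(1) shift_int memory(1)
    by (simp add: Bochner_Integration.integral_sum shift(1))
  define V where "V = (\<Sum>i=1..n. estimator_variance \<sigma> i)"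
  define g where "g = (\<Sum>i=1..n. (norm (G i x - G i xs))\<^sup>2)"
  have g: "g \<le> q"
  proof -
    have "real m * (norm (G i x - G i xs))\<^sup>2 \<le> (\<Sum>j=1..m. (norm (gradient (f i j) x - gradient (f i j) xs))\<^sup>2)"
      if "i \<in> {1..n}" for i
      using norm_sq_mean_le[OF m_pos, of "\<lambda>j. gradient (f i j) x - gradient (f i j) xs"] that
      by (simp add: G_def gradient_worker_objective sum_subtractf scaleR_diff_right)
    then have "real m * g \<le> deviation x"
      unfolding g_def deviation_def sum_distrib_left by (rule sum_mono)
    then show ?thesis
      using m_pos by (simp add: q_def field_simps)
  qed
  have V: "V \<le> 2 * q + 2 * D / real m"
  proof -
    have "real m * V \<le> (\<Sum>i=1..n. 2 * (\<Sum>j=1..m. (norm (gradient (f i j) x - gradient (f i j) xs))\<^sup>2)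
        + 2 * (\<Sum>j=1..m. (norm (gradient (f i j) (st_w \<sigma> i j) - gradient (f i j) xs))\<^sup>2))"
      unfolding V_def sum_distrib_left[of "real m"] x_def by (intro sum_mono estimator_variance_le)
    also have "\<dots> = 2 * deviation x + 2 * D"
      unfolding deviation_def D_def D_term_def by (simp only: sum.distrib sum_distrib_left)
    finally have "real m * V \<le> 2 * deviation x + 2 * D" .
    then show ?thesis
      using m_pos by (simp add: q_def field_simps)
  qed
  have d: "(\<Sum>i=1..n. (norm (G i x - st_h \<sigma> i))\<^sup>2) \<le> 2 * q + 2 * H"
  proof -
    have "(\<Sum>i=1..n. (norm (G i x - st_h \<sigma> i))\<^sup>2)
        \<le> (\<Sum>i=1..n. 2 * (norm (G i x - G i xs))\<^sup>2 + 2 * (norm (st_h \<sigma> i - G i xs))\<^sup>2)"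
      using norm_sq_diff_le[of "G i x - G i xs" "st_h \<sigma> i - G i xs" for i] by (intro sum_mono) simp
    also have "\<dots> = 2 * g + 2 * H"
      by (simp add: g_def H_def H_term_def G_def sum.distrib sum_distrib_left)
    finally show ?thesis
      using g by simp
  qed
  \<comment> \<open>The gradients at the minimizer sum to zero, so they may be subtracted worker by worker.\<close>
  have full: "(norm (gradient (objective n m f) x))\<^sup>2 \<le> q / real n"
  proof -
    have "gradient (objective n m f) x = (1 / real n) *\<^sub>R (\<Sum>i=1..n. G i x - G i xs)"
      using sum_worker_gradients_minimizer by (simp add: gradient_objective G_def sum_subtractf)
    then have "real n * (norm (gradient (objective n m f) x))\<^sup>2 \<le> q"
      using norm_sq_mean_le[OF n_pos, of "\<lambda>i. G i x - G i xs"] g by (simp add: g_def)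
    then show ?thesis
      using n_pos by (simp add: field_simps)
  qed
  have sum_shift: "(\<Sum>i=1..n. expectation (shift i)) \<le> (1 - \<alpha>) * H + \<alpha> * (q + V)"
  proof -
    have "(\<Sum>i=1..n. expectation (shift i)) \<le> (\<Sum>i=1..n. (1 - \<alpha>) * (norm (st_h \<sigma> i - G i xs))\<^sup>2
        + \<alpha> * ((norm (G i x - G i xs))\<^sup>2 + estimator_variance \<sigma> i))"
      by (intro sum_mono shift)
    also have "\<dots> = (1 - \<alpha>) * H + \<alpha> * (g + V)"
      unfolding H_def H_term_def g_def V_def G_def
      by (simp only: sum.distrib sum_distrib_left[symmetric])
    also have "\<dots> \<le> (1 - \<alpha>) * H + \<alpha> * (q + V)"
      using g \<alpha>_pos by simp
    finally show ?thesis .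
  qed
  have q_nonneg: "0 \<le> q" and H_nonneg: "0 \<le> H" and D_nonneg: "0 \<le> D"
    by (auto simp: q_def deviation_def H_def H_term_def D_def D_term_def intro!: sum_nonneg divide_nonneg_nonneg)
  have q_le: "q \<le> 2 * L * real n * gap x"
    using deviation_le_gap[of x] m_pos by (simp add: q_def field_simps)
  have iterate_le: "expectation iterate \<le> (norm (x - xs))\<^sup>2 - 2 * \<gamma> * (gradient (objective n m f) x \<bullet> (x - xs))
      + \<gamma>\<^sup>2 * ((norm (gradient (objective n m f) x))\<^sup>2
        + (1 / (real n)\<^sup>2) * (\<omega> * (\<Sum>i=1..n. (norm (G i x - st_h \<sigma> i))\<^sup>2) + (\<omega> + 1) * V))"
    using iterate(2) unfolding V_def by (simp only: sum.distrib sum_distrib_left)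
  show "expectation (\<lambda>z. potential (step k \<sigma> z)) \<le> (1 - \<rho>) * potential \<sigma>"
    unfolding expect
    using contraction_arithmetic[OF _ q_nonneg H_nonneg D_nonneg q_le gap_strongly_convex
        iterate_le full d V sum_shift, of "expectation memory"] memory(2)
    by (simp add: lyapunov_def H_def D_def x_def q_def)
qed

section \<open>From one round to the conditional expectation\<close>

abbreviation process :: "'v vr_state \<Rightarrow> nat \<Rightarrow> 'a \<Rightarrow> 'v vr_state" where
  "process \<sigma>0 \<equiv> vr_diana v n m f Q \<alpha> \<gamma> \<sigma>0 U J S"

lemma process_Suc: "process \<sigma>0 (Suc k) z = step k (process \<sigma>0 k z) z"
  by (simp add: step_def)

lemma current_draws_mem:
  "v = L_SVRG \<Longrightarrow> Coin k \<in> current_draws k"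
  "i \<in> {1..n} \<Longrightarrow> Index k i \<in> current_draws k"
  "i \<in> {1..n} \<Longrightarrow> Seed k i \<in> current_draws k"
  unfolding current_draws_def draws_of_def by auto

lemma measurable_subalgebra_ident: "subalgebra A B \<Longrightarrow> (\<lambda>z. z) \<in> measurable A B"
  using measurable_from_subalg[of A B "\<lambda>z. z" B] by simp

lemma state_measurable_round:
  assumes X: "state_measurable n m A X" and g: "g \<in> measurable A (draw_algebra (current_draws k))"
  shows "state_measurable n m A (\<lambda>p. step k (X p) (g p))"
  unfolding step_def
  by (rule state_measurable_step[where U = "\<lambda>p. U k (g p)" and J = "\<lambda>p i. J k i (g p)"
        and S = "\<lambda>p i. S k i (g p)", OF measurable_gradient Q_measurable X])
    (assumption | rule measurable_compose[OF g] measurable_coin measurable_index measurable_seed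
      current_draws_mem)+

text \<open>The state at the start of round \<open>k\<close> is a function of the draws of earlier rounds.\<close>
lemma process_past_measurable:
  "state_measurable n m (draw_algebra (past_draws k)) (process \<sigma>0 k)"
proof (induction k)
  case 0
  show ?case
    by (simp add: state_measurable_def)
next
  case (Suc k)
  have "past_draws k \<subseteq> past_draws (Suc k)" "current_draws k \<subseteq> past_draws (Suc k)"
    by (auto simp: past_draws_def current_draws_def)
  then have ident: "(\<lambda>z. z) \<in> measurable (draw_algebra (past_draws (Suc k))) (draw_algebra (past_draws k))"
    "(\<lambda>z. z) \<in> measurable (draw_algebra (past_draws (Suc k))) (draw_algebra (current_draws k))"
    by (auto intro: measurable_subalgebra_ident draw_algebra_mono)
  show ?case
    using state_measurable_round[OF state_measurable_compose[OF Suc.IH ident(1)] ident(2)]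
    by (simp add: process_Suc[abs_def])
qed

lemma \<rho>_le_1: "\<rho> \<le> 1"
proof -
  have "1 / (\<omega> + 1) \<le> 1"
    using \<omega>_nonneg by simp
  then show ?thesis
    using \<alpha>_le \<rho>_le(2) \<alpha>_pos by linarith
qed

lemma measurable_potential: "state_measurable n m A X \<Longrightarrow> (\<lambda>z. potential (X z)) \<in> borel_measurable A"
  using measurable_gradient by (rule measurable_lyapunov)

text \<open>Decoupling replaces the current outcome by an independent copy, so the state inside the inner
  integral is a constant and the bound from a fixed state applies. Nonnegative integrals are used
  because integrability of the potential is itself deduced from this inequality, by induction
  on the round.\<close>
lemma nn_integral_contraction:
  assumes A: "A \<in> sets (draw_algebra (past_draws k))"
  shows "(\<integral>\<^sup>+z. ennreal (indicator A z * potential (process \<sigma>0 (Suc k) z)) \<partial>M)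
    \<le> (\<integral>\<^sup>+z. ennreal (indicator A z * ((1 - \<rho>) * potential (process \<sigma>0 k z))) \<partial>M)"
proof -
  let ?F = "draw_algebra (past_draws k)" and ?G = "draw_algebra (current_draws k)"
  define \<phi> where "\<phi> p = ennreal (indicator A (fst p) * potential (step k (process \<sigma>0 k (fst p)) (snd p)))" for p
  have "state_measurable n m (?F \<Otimes>\<^sub>M ?G) (\<lambda>p. step k (process \<sigma>0 k (fst p)) (snd p))"
    by (intro state_measurable_round measurable_snd
        state_measurable_compose[OF process_past_measurable measurable_fst])
  then have [measurable]: "(\<lambda>p. potential (step k (process \<sigma>0 k (fst p)) (snd p))) \<in> borel_measurable (?F \<Otimes>\<^sub>M ?G)"
    by (rule measurable_potential)
  have [measurable]: "(\<lambda>p. indicator A (fst p) :: real) \<in> borel_measurable (?F \<Otimes>\<^sub>M ?G)"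
    using A by (intro measurable_compose[OF measurable_fst borel_measurable_indicator])
  have \<phi>: "\<phi> \<in> borel_measurable (?F \<Otimes>\<^sub>M ?G)"
    unfolding \<phi>_def by measurable
  have "(\<integral>\<^sup>+z. ennreal (indicator A z * potential (process \<sigma>0 (Suc k) z)) \<partial>M) = (\<integral>\<^sup>+z. \<phi> (z, z) \<partial>M)"
    by (simp only: process_Suc \<phi>_def fst_conv snd_conv)
  also have "\<dots> = (\<integral>\<^sup>+y. \<integral>\<^sup>+z. \<phi> (y, z) \<partial>M \<partial>M)"
    by (intro nn_integral_decouple[OF _ _ _ \<phi>] subalgebra_draw_algebra indep_draw_algebras
        past_draws_subset current_draws_subset past_current_disjoint)
  also have "\<dots> \<le> (\<integral>\<^sup>+y. ennreal (indicator A y * ((1 - \<rho>) * potential (process \<sigma>0 k y))) \<partial>M)"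
  proof (rule nn_integral_mono)
    fix y
    let ?\<sigma> = "process \<sigma>0 k y"
    have "(\<integral>\<^sup>+z. \<phi> (y, z) \<partial>M) = ennreal (expectation (\<lambda>z. indicator A y * potential (step k ?\<sigma> z)))"
      unfolding \<phi>_def fst_conv snd_conv
      by (intro nn_integral_eq_integral integrable_mult_right one_step_contraction(1))
        (simp add: potential_nonneg)
    also have "\<dots> = ennreal (indicator A y * expectation (\<lambda>z. potential (step k ?\<sigma> z)))"
      by simp
    also have "\<dots> \<le> ennreal (indicator A y * ((1 - \<rho>) * potential ?\<sigma>))"
      by (intro ennreal_leI mult_left_mono one_step_contraction(2)) simp
    finally show "(\<integral>\<^sup>+z. \<phi> (y, z) \<partial>M) \<le> ennreal (indicator A y * ((1 - \<rho>) * potential ?\<sigma>))" .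
  qed
  finally show ?thesis .
qed

lemma integrable_potential: "integrable M (\<lambda>z. potential (process \<sigma>0 k z))"
proof (induction k)
  case 0
  show ?case
    by simp
next
  case (Suc k)
  have A: "space M \<in> sets (draw_algebra (past_draws k))"
    using sets.top[of "draw_algebra (past_draws k)"] by simp
  have meas: "(\<lambda>z. potential (process \<sigma>0 (Suc k) z)) \<in> borel_measurable M"
    using measurable_from_subalg[OF subalgebra_draw_algebra[OF past_draws_subset]
        measurable_potential[OF process_past_measurable]] .
  have "(\<integral>\<^sup>+z. ennreal (potential (process \<sigma>0 (Suc k) z)) \<partial>M)
      = (\<integral>\<^sup>+z. ennreal (indicator (space M) z * potential (process \<sigma>0 (Suc k) z)) \<partial>M)"
    by (rule nn_integral_cong) simp
  also have "\<dots> \<le> (\<integral>\<^sup>+z. ennreal (indicator (space M) z * ((1 - \<rho>) * potential (process \<sigma>0 k z))) \<partial>M)"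
    by (rule nn_integral_contraction[OF A])
  also have "\<dots> = (\<integral>\<^sup>+z. ennreal ((1 - \<rho>) * potential (process \<sigma>0 k z)) \<partial>M)"
    by (rule nn_integral_cong) simp
  also have "\<dots> = ennreal (expectation (\<lambda>z. (1 - \<rho>) * potential (process \<sigma>0 k z)))"
    using Suc.IH \<rho>_le_1 by (intro nn_integral_eq_integral) (auto simp: potential_nonneg)
  also have "\<dots> < \<infinity>"
    by simp
  finally show ?case
    using meas by (intro integrableI_nonneg) (auto simp: potential_nonneg)
qed

lemma set_integral_contraction:
  assumes A: "A \<in> sets (draw_algebra (past_draws k))"
  shows "(\<integral>z\<in>A. potential (process \<sigma>0 (Suc k) z) \<partial>M) \<le> (\<integral>z\<in>A. (1 - \<rho>) * potential (process \<sigma>0 k z) \<partial>M)"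
proof -
  have A': "A \<in> events"
    using A subalgebra_draw_algebra[OF past_draws_subset] by (auto simp: subalgebra_def)
  have int: "integrable M (\<lambda>z. indicator A z * h z)" if "integrable M h" for h :: "'a \<Rightarrow> real"
    using integrable_mult_indicator[OF A' that] by simp
  let ?s = "\<lambda>z. indicator A z * potential (process \<sigma>0 (Suc k) z)"
  let ?t = "\<lambda>z. indicator A z * ((1 - \<rho>) * potential (process \<sigma>0 k z))"
  have nonneg: "0 \<le> ?s z" "0 \<le> ?t z" for z
    using potential_nonneg \<rho>_le_1 by simp_all
  have s: "integrable M ?s" and t: "integrable M ?t"
    by (intro int integrable_potential integrable_mult_right)+
  have "ennreal (integral\<^sup>L M ?s) = (\<integral>\<^sup>+z. ennreal (?s z) \<partial>M)"
    using s nonneg(1) by (intro nn_integral_eq_integral[symmetric]) auto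
  also have "\<dots> \<le> (\<integral>\<^sup>+z. ennreal (?t z) \<partial>M)"
    by (rule nn_integral_contraction[OF A])
  also have "\<dots> = ennreal (integral\<^sup>L M ?t)"
    using t nonneg(2) by (intro nn_integral_eq_integral) auto
  finally have "integral\<^sup>L M ?s \<le> integral\<^sup>L M ?t"
    using nonneg(2) by (subst (asm) ennreal_le_iff) (auto intro: Bochner_Integration.integral_nonneg)
  then show ?thesis
    unfolding set_lebesgue_integral_def real_scaleR_def .
qed

text \<open>The state algebra is coarser than the algebra of past draws, and the right-hand side is measurable
  with respect to it, so it suffices to compare integrals over its events.\<close>
lemma conditional_contraction:
  fixes \<sigma>0 :: "'v vr_state" and k :: nat
  defines "F \<equiv> state_algebra M n m (process \<sigma>0 k)"
  shows "subalgebra M F"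
    "AE z in M. real_cond_exp M F (\<lambda>z. potential (process \<sigma>0 (Suc k) z)) z
      \<le> (1 - \<rho>) * potential (process \<sigma>0 k z)"
proof -
  have past: "subalgebra (draw_algebra (past_draws k)) F"
    unfolding F_def by (rule subalgebra_state_algebra[OF process_past_measurable]) simp
  then show F: "subalgebra M F"
    using subalgebra_draw_algebra[OF past_draws_subset, of k] by (auto simp: subalgebra_def)
  show "AE z in M. real_cond_exp M F (\<lambda>z. potential (process \<sigma>0 (Suc k) z)) z
      \<le> (1 - \<rho>) * potential (process \<sigma>0 k z)"
  proof (rule real_cond_exp_le[OF F])
    have "(\<lambda>z. potential (process \<sigma>0 k z)) \<in> borel_measurable F"
      unfolding F_def by (rule measurable_potential[OF state_measurable_state_algebra])
    then show "(\<lambda>z. (1 - \<rho>) * potential (process \<sigma>0 k z)) \<in> borel_measurable F"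
      by simp
    fix A assume "A \<in> sets F"
    then have "A \<in> sets (draw_algebra (past_draws k))"
      using past by (auto simp: subalgebra_def)
    then show "(\<integral>z\<in>A. potential (process \<sigma>0 (Suc k) z) \<partial>M)
        \<le> (\<integral>z\<in>A. (1 - \<rho>) * potential (process \<sigma>0 k z) \<partial>M)"
      by (rule set_integral_contraction)
  qed (intro integrable_potential integrable_mult_right)+
qed

end

theorem theorem2:
  fixes f :: "nat \<Rightarrow> nat \<Rightarrow> real ^ 'd \<Rightarrow> real"
    and n m :: nat
    and L \<mu> \<omega> \<alpha> \<gamma> b c \<rho> :: real
    and xs :: "real ^ 'd"
    and R :: "'r measure"
    and Q :: "'r \<Rightarrow> real ^ 'd \<Rightarrow> real ^ 'd"
    and v :: variant
    and \<sigma>0 :: "(real ^ 'd) vr_state"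
    and M :: "'a measure"
    and U :: "nat \<Rightarrow> 'a \<Rightarrow> bool"
    and J :: "nat \<Rightarrow> nat \<Rightarrow> 'a \<Rightarrow> nat"
    and S :: "nat \<Rightarrow> nat \<Rightarrow> 'a \<Rightarrow> 'r"
    and X :: "nat \<Rightarrow> 'a \<Rightarrow> (real ^ 'd) vr_state"
    and \<psi> :: "(real ^ 'd) vr_state \<Rightarrow> real"
    and k :: nat
  assumes "n \<ge> 1" and "m \<ge> 1"
    and "\<And>i j. i \<in> {1..n} \<Longrightarrow> j \<in> {1..m} \<Longrightarrow> convex_on UNIV (f i j)"
    and "\<And>i j. i \<in> {1..n} \<Longrightarrow> j \<in> {1..m} \<Longrightarrow> L_smooth L (f i j)"
    and "\<And>i. i \<in> {1..n} \<Longrightarrow> strongly_convex \<mu> (worker_objective m f i)"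
    and "\<mu> > 0"
    and "is_arg_min (objective n m f) (\<lambda>_. True) xs"
    and "quantization_operator \<omega> R Q"
    and "0 < \<alpha>" and "\<alpha> \<le> 1 / (\<omega> + 1)"
    and "\<gamma> = 1 / (L * (1 + 36 * (\<omega> + 1) / real n))"
    and "b = 4 * (\<omega> + 1) / (\<alpha> * (real n)\<^sup>2)"
    and "c = 16 * (\<omega> + 1) / (real n)\<^sup>2"
    and "\<rho> = Min {\<mu> / (L * (1 + 36 * ((\<omega> + 1) / real n))), \<alpha> / 2, 3 / (8 * real m)}"
    and "vr_diana_draws v n m M R U J S"
    and "X = vr_diana v n m f Q \<alpha> \<gamma> \<sigma>0 U J S"
    and "\<psi> = lyapunov n m f xs b c \<gamma>"
  shows "subalgebra M (state_algebra M n m (X k)) \<and>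
    integrable M (\<lambda>z. \<psi> (X (Suc k) z)) \<and>
    (AE z in M. real_cond_exp M (state_algebra M n m (X k)) (\<lambda>z. \<psi> (X (Suc k) z)) z
                  \<le> (1 - \<rho>) * \<psi> (X k z))"
proof -
  let ?r = "\<mu> / (L * (1 + 36 * ((\<omega> + 1) / real n)))"
  have "\<rho> \<le> ?r" "\<rho> \<le> \<alpha> / 2" "\<rho> \<le> 3 / (8 * real m)"
    unfolding assms(14) by (intro Min.coboundedI; simp)+
  moreover have "?r = \<gamma> * \<mu>"
    unfolding assms(11) by simp
  ultimately interpret vr_diana_setting f n m L \<mu> \<omega> \<alpha> \<gamma> b c \<rho> xs R Q v M U J S
    using assms(1-15) by unfold_locales simp_all
  show ?thesis
    unfolding assms(16,17)
    using conditional_contraction[of \<sigma>0 k] integrable_potential[of \<sigma>0 "Suc k"] by blast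
qed

end
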